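(* Let $n\ge1$ and let $X$ be a set with $|X|=2n$. There exists a bijection $\Psi$ between (a) the set of top-degree pairs $(M,\prec)$ where $M$ is a non-oriented map with $n$ edges and edge-side labels from $X$, and (b) the set of pairs $(M,\prec)$ where $M$ is an orientable non-oriented map with $n$ edges and edge-side labels from $X$ and $\prec$ is a history on $M$; moreover, if $\Psi(M,\prec)=(M',\prec')$ then $M$ and $M'$, regarded as bicolored graphs, are isomorphic.
   Context: A non-oriented map with edge-side labels from $X$ is a triple $(\mathcal{B},\mathcal{W},\mathcal{E})$ of pairings (partitions into $2$-element blocks) of $X$: the pairs of $\mathcal{B}$ and $\mathcal{W}$ are the corners at black and white vertices respectively, so $\mathcal{B}\cup\mathcal{W}$ forms bicolored polygons (faces) with sides labeled by $X$, and gluing sides according to $\mathcal{E}$ yields a bicolored graph embedded in a closed, possibly disconnected, possibly non-orientable surface; the edges are the pairs of $\mathcal{E}$. Equivalently it is a ribbon graph. A map is orientable if its surface is orientable. A history on $M$ is a linear order on its edges. For a history with edges $E_1,\dots,E_n$ in order, let $M_i=M\setminus\{E_1,\dots,E_i\}$, where removing an edge means deleting the ribbon and any vertex that becomes isolated. A map is top-degree if each of its connected components has exactly one face; $(M,\prec)$ is a top-degree pair if each of $M_0,\dots,M_n$ is top-degree. *)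

theory Defs
  imports Main "HOL-Library.Disjoint_Sets"
begin

definition pairing_on :: "'a set \<Rightarrow> 'a set set \<Rightarrow> bool" where
  "pairing_on X P \<longleftrightarrow> partition_on X P \<and> (\<forall>p\<in>P. card p = 2)"

text \<open>The three pairings of a non-oriented map. A label is one side of an edge; a pair in
  \<open>black_corners\<close> consists of the two sides meeting at a corner of a black vertex, and
  similarly for \<open>white_corners\<close>. A pair in \<open>edges\<close> is glued so that black ends meet black
  ends and white ends meet white ends.\<close>

datatype 'a bimap =
  Bimap (black_corners: "'a set set") (white_corners: "'a set set") (edges: "'a set set")

definition nonoriented_map :: "'a set \<Rightarrow> 'a bimap \<Rightarrow> bool" where
  "nonoriented_map X M \<longleftrightarrow>
     pairing_on X (black_corners M) \<and> pairing_on X (white_corners M) \<and> pairing_on X (edges M)"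

text \<open>\<open>orbits P\<close>: the connected components of the graph on \<open>\<Union>P\<close> whose edges are the
  pairs in \<open>P\<close>.\<close>

definition linked :: "'a set set \<Rightarrow> 'a rel" where
  "linked P = {(x, y). \<exists>p\<in>P. x \<in> p \<and> y \<in> p}"

definition orbits :: "'a set set \<Rightarrow> 'a set set" where
  "orbits P = \<Union>P // (linked P)\<^sup>+"

text \<open>Faces, vertices and connected components are represented by the sets of edge-sides they
  contain. The sides around a black vertex are met by alternately crossing a corner of that
  vertex and passing to the other side of an edge, and likewise for white vertices.\<close>

definition faces :: "'a bimap \<Rightarrow> 'a set set" where
  "faces M = orbits (black_corners M \<union> white_corners M)"

definition black_vertices :: "'a bimap \<Rightarrow> 'a set set" where
  "black_vertices M = orbits (black_corners M \<union> edges M)"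

definition white_vertices :: "'a bimap \<Rightarrow> 'a set set" where
  "white_vertices M = orbits (white_corners M \<union> edges M)"

definition components :: "'a bimap \<Rightarrow> 'a set set" where
  "components M = orbits (black_corners M \<union> white_corners M \<union> edges M)"

text \<open>Orienting the boundaries of all polygons amounts to choosing, for every side \<open>x\<close>,
  whether it is traversed from its black end to its white end (\<open>d x\<close>) or the other way
  (\<open>\<not> d x\<close>), such that of the two sides meeting at a corner one enters the corner and the
  other leaves it.\<close>

definition boundary_orientation :: "'a bimap \<Rightarrow> ('a \<Rightarrow> bool) \<Rightarrow> bool" where
  "boundary_orientation M d \<longleftrightarrow>
     (\<forall>x y. x \<noteq> y \<and> {x, y} \<in> black_corners M \<union> white_corners M \<longrightarrow> d x \<noteq> d y)"

text \<open>The glued surface is orientable iff the polygons can be oriented coherently, i.e. such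
  that any two glued sides are traversed in opposite directions; as the gluing preserves the
  colours of the ends, this says that exactly one of them runs from black to white.\<close>

definition orientable :: "'a bimap \<Rightarrow> bool" where
  "orientable M \<longleftrightarrow>
     (\<exists>d. boundary_orientation M d \<and> (\<forall>x y. x \<noteq> y \<and> {x, y} \<in> edges M \<longrightarrow> d x \<noteq> d y))"

text \<open>When the ribbon with sides \<open>e = {x, y}\<close> is deleted, the corners \<open>{a, x}\<close> and
  \<open>{b, y}\<close> on its two sides at one end merge into the corner \<open>{a, b}\<close>. If instead
  \<open>{x, y}\<close> is itself a corner, the vertex there has degree 1, becomes isolated, and
  vanishes together with that corner.\<close>

definition merge_corners :: "'a set \<Rightarrow> 'a set set \<Rightarrow> 'a set set" where
  "merge_corners e P = {p \<in> P. p \<inter> e = {}} \<union>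
     {{a, b} | a b x y. e = {x, y} \<and> {a, x} \<in> P \<and> {b, y} \<in> P \<and> a \<notin> e \<and> b \<notin> e}"

definition remove_edge :: "'a set \<Rightarrow> 'a bimap \<Rightarrow> 'a bimap" where
  "remove_edge e M =
     Bimap (merge_corners e (black_corners M)) (merge_corners e (white_corners M)) (edges M - {e})"

definition history :: "'a bimap \<Rightarrow> 'a set rel \<Rightarrow> bool" where
  "history M r \<longleftrightarrow> linear_order_on (edges M) r"

definition top_degree :: "'a bimap \<Rightarrow> bool" where
  "top_degree M \<longleftrightarrow> (\<forall>C\<in>components M. \<exists>!F. F \<in> faces M \<and> F \<subseteq> C)"

text \<open>\<open>edges_in_order M r es\<close>: \<open>es\<close> lists the edges \<open>E\<^sub>1, \<dots>, E\<^sub>n\<close> of \<open>M\<close> in the order \<open>r\<close>;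
  then \<open>fold remove_edge (take i es) M\<close> is the map with \<open>E\<^sub>1, \<dots>, E\<^sub>i\<close> removed.\<close>

definition edges_in_order :: "'a bimap \<Rightarrow> 'a set rel \<Rightarrow> 'a set list \<Rightarrow> bool" where
  "edges_in_order M r es \<longleftrightarrow>
     distinct es \<and> set es = edges M \<and> sorted_wrt (\<lambda>e f. (e, f) \<in> r) es"

definition top_degree_pair :: "'a bimap \<Rightarrow> 'a set rel \<Rightarrow> bool" where
  "top_degree_pair M r \<longleftrightarrow> history M r \<and>
     (\<exists>es. edges_in_order M r es \<and>
        (\<forall>i\<le>length es. top_degree (fold remove_edge (take i es) M)))"

text \<open>Isomorphism of the underlying bicolored graphs (multiple edges allowed), preserving the
  colours. An edge is incident to a vertex iff its sides are among those around the vertex.\<close>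

definition bicolored_graph_isomorphic :: "'a bimap \<Rightarrow> 'a bimap \<Rightarrow> bool" where
  "bicolored_graph_isomorphic M M' \<longleftrightarrow> (\<exists>\<beta> \<omega> \<epsilon>.
     bij_betw \<beta> (black_vertices M) (black_vertices M') \<and>
     bij_betw \<omega> (white_vertices M) (white_vertices M') \<and>
     bij_betw \<epsilon> (edges M) (edges M') \<and>
     (\<forall>e\<in>edges M. \<forall>v\<in>black_vertices M. e \<subseteq> v \<longleftrightarrow> \<epsilon> e \<subseteq> \<beta> v) \<and>
     (\<forall>e\<in>edges M. \<forall>v\<in>white_vertices M. e \<subseteq> v \<longleftrightarrow> \<epsilon> e \<subseteq> \<omega> v))"

end

theory Submission
  imports Defs
begin

text \<open>Fix the edges, their order \<open>E\<^sub>1, \<dots>, E\<^sub>n\<close> and the bicolored graph, and remove \<open>E\<^sub>1 = {x, y}\<close>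
  from a map. The map is recovered from the smaller one by choosing the corners at the two ends
  into which the ribbon is inserted, and at each end which side of it goes where. If the two ends
  lie in different components of the remaining graph, or one of them is a new vertex, then every
  choice preserves both orientability and having one face per component. If they are old vertices
  of the same component, then of the two ways to insert the ribbon into given corners (up to
  exchanging \<open>x\<close> and \<open>y\<close>) exactly one, the untwisted one, preserves orientability, and exactly
  one, the twisted one, does not split the unique face. So both kinds of maps have the same number
  of extensions, which depends on the graph only, and by induction there are equally many of them
  for each graph. The bijection can thus be chosen to preserve the edges, their order and the
  vertices.

  Connectivity is encoded by invariants: sides are connected by a set of pairs if no Boolean
  function constant on the pairs separates them.\<close>

subsection \<open>Inserting a ribbon into a pairing\<close>

text \<open>Both counts rest on one test. Let \<open>d\<close> orient the polygons of the smaller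
  map and let \<open>x\<close> face the sides \<open>a\<close> and \<open>b\<close> at the two ends
  of the ribbon. If both ends are old vertices of one component, the extension is orientable iff
  \<open>d a = d b\<close>, and it keeps one face per component iff \<open>d a \<noteq> d b\<close>.
  The two uses of \<open>d\<close> differ: for an orientable map it is also coherent along the
  edges, while for a top-degree map it is any orientation of the polygons, which always exists.
  Exchanging the two sides of an old corner reverses \<open>d\<close>, so either test admits, for
  each \<open>a\<close>, exactly half of the candidates \<open>b\<close>.

  The smaller maps of the two kinds are not related to each other, so no extension is transported;
  only cardinalities are compared. Hence the number of extensions has to be a function of a label
  that both kinds share and on which deletion of an edge acts. This label consists of the edges,
  their order and the two partitions into vertices, the latter given as sets of invariants.
  Orientability survives deletion, so it may be demanded at every stage of the history, which gives
  both kinds the same recursive form.\<close>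

definition mate :: "'a set set \<Rightarrow> 'a \<Rightarrow> 'a" where
  "mate P a = (THE b. b \<noteq> a \<and> {a, b} \<in> P)"

lemma mate_eq_iff:
  assumes "pairing_on X P" "a \<in> X"
  shows "mate P a = b \<longleftrightarrow> {a, b} \<in> P"
proof -
  have sz: "\<And>p. p \<in> P \<Longrightarrow> card p = 2" and UX: "\<Union>P = X"
    and dj: "\<And>p q. p \<in> P \<Longrightarrow> q \<in> P \<Longrightarrow> p \<noteq> q \<Longrightarrow> p \<inter> q = {}"
    using assms(1) by (auto simp: pairing_on_def partition_on_def disjoint_def)
  have ne: "b \<noteq> a" if "{a, b} \<in> P" for b using sz[OF that] by auto
  obtain p where p: "p \<in> P" "a \<in> p" using assms(2) UX by blast
  obtain b0 where b0: "p = {a, b0}" "b0 \<noteq> a"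
    using sz[OF p(1)] p(2) by (auto simp: card_2_iff doubleton_eq_iff)
  have uniq: "b = b0" if "{a, b} \<in> P" for b
  proof -
    have "{a, b} = p" using dj[OF that p(1)] p(2) by blast
    then show ?thesis using b0 by (auto simp: doubleton_eq_iff)
  qed
  have "mate P a = b0" unfolding mate_def 
  proof (rule the_equality)
    show "b0 \<noteq> a \<and> {a, b0} \<in> P" using p(1) b0 by simp
  qed (use uniq in blast)
  then show ?thesis using uniq p(1) b0(1) by blast
qed

context
  fixes X :: "'a set" and P :: "'a set set"
  assumes pairing: "pairing_on X P"
begin

lemma pairing_Union: "\<Union>P = X"
  using pairing by (simp add: pairing_on_def partition_on_def)

lemma pair_mem: "{a, b} \<in> P \<Longrightarrow> a \<in> X" "{a, b} \<in> P \<Longrightarrow> b \<in> X"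
  using pairing_Union by auto

lemma pair_neq: "{a, b} \<in> P \<Longrightarrow> a \<noteq> b"
  using pairing by (fastforce simp: pairing_on_def)

lemma pair_iff: "{a, b} \<in> P \<longleftrightarrow> a \<in> X \<and> mate P a = b"
  using mate_eq_iff[OF pairing] pair_mem by blast

lemma mate_pair: "a \<in> X \<Longrightarrow> {a, mate P a} \<in> P"
  by (simp add: pair_iff)

lemma mate_mem: "a \<in> X \<Longrightarrow> mate P a \<in> X"
  using mate_pair pair_mem by blast

lemma mate_neq: "a \<in> X \<Longrightarrow> mate P a \<noteq> a"
  using mate_pair pair_neq by metis

lemma mate_mate: "a \<in> X \<Longrightarrow> mate P (mate P a) = a"
  using mate_pair pair_iff by (metis insert_commute)

lemma pairing_cases:
  assumes "p \<in> P" obtains a where "a \<in> X" "p = {a, mate P a}"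
proof -
  obtain a b where "p = {a, b}"
    using assms pairing by (auto simp: pairing_on_def card_2_iff)
  then show ?thesis using that assms by (auto simp: pair_iff)
qed

end

lemma pairing_onI:
  assumes "\<And>p. p \<in> P \<Longrightarrow> \<exists>a b. a \<in> X \<and> b \<in> X \<and> a \<noteq> b \<and> p = {a, b}"
    and "\<And>a. a \<in> X \<Longrightarrow> \<exists>b. {a, b} \<in> P"
    and "\<And>a b c. {a, b} \<in> P \<Longrightarrow> {a, c} \<in> P \<Longrightarrow> b = c"
  shows "pairing_on X P"
proof -
  have "p = q" if pq: "p \<in> P" "q \<in> P" "z \<in> p" "z \<in> q" for p q z
  proof -
    obtain b where "p = {z, b}" using assms(1)[OF pq(1)] pq(3) by auto
    moreover obtain c where "q = {z, c}" using assms(1)[OF pq(2)] pq(4) by auto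
    ultimately show ?thesis using assms(3)[of z b c] pq by simp
  qed
  then have "disjoint P" unfolding disjoint_def by blast
  moreover have "\<Union>P = X"
  proof (intro equalityI subsetI)
    fix a assume "a \<in> \<Union>P" then show "a \<in> X" using assms(1) by fastforce
  next
    fix a assume "a \<in> X"
    then obtain b where "{a, b} \<in> P" using assms(2) by blast
    then show "a \<in> \<Union>P" by blast
  qed
  moreover have "card p = 2" if "p \<in> P" for p using assms(1)[OF that] by (auto simp: card_2_iff)
  moreover have "{} \<notin> P" using assms(1)[of "{}"] by blast
  ultimately show ?thesis unfolding pairing_on_def partition_on_def by simp
qed

text \<open>A right inverse of \<open>merge_corners {x, y}\<close>: the corner \<open>{a, mate P a}\<close> is split by a ribbon
  whose side \<open>x\<close> faces \<open>a\<close>.\<close>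

definition insert_ribbon :: "'a \<Rightarrow> 'a \<Rightarrow> 'a \<Rightarrow> 'a set set \<Rightarrow> 'a set set" where
  "insert_ribbon x y a P = P - {{a, mate P a}} \<union> {{a, x}, {mate P a, y}}"

context
  fixes x y :: 'a and X' :: "'a set"
  assumes new: "x \<noteq> y" "x \<notin> X'" "y \<notin> X'"
begin

context
  fixes P :: "'a set set"
  assumes P: "pairing_on X' P"
begin

lemma new_pair_notin: "{x, z} \<notin> P" "{z, x} \<notin> P" "{y, z} \<notin> P" "{z, y} \<notin> P"
  using new by (auto dest: pair_mem[OF P])

lemma pairing_insert_edge: "pairing_on (insert x (insert y X')) (insert {x, y} P)"
proof (rule pairing_onI)
  fix p assume "p \<in> insert {x, y} P"
  then show "\<exists>a b. a \<in> insert x (insert y X') \<and> b \<in> insert x (insert y X') \<and> a \<noteq> b \<and> p = {a, b}"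
    using new pairing_cases[OF P] mate_mem[OF P] mate_neq[OF P] by (metis insertE insertI1 insertI2)
next
  fix a assume "a \<in> insert x (insert y X')"
  then consider "a = x" | "a = y" | "a \<in> X'" by blast
  then show "\<exists>b. {a, b} \<in> insert {x, y} P"
    using mate_pair[OF P] by cases (auto simp: doubleton_eq_iff)
next
  fix a b c assume "{a, b} \<in> insert {x, y} P" "{a, c} \<in> insert {x, y} P"
  then show "b = c" using new_pair_notin by (auto simp: doubleton_eq_iff pair_iff[OF P])
qed

lemma merge_insert_edge: "merge_corners {x, y} (insert {x, y} P) = P"
proof -
  have "p \<inter> {x, y} = {}" if "p \<in> P" for p using that pairing_Union[OF P] new by blast
  then show ?thesis
    using new_pair_notin new unfolding merge_corners_def by (auto simp: doubleton_eq_iff)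
qed

lemma pair_insert_ribbon_iff:
  assumes "a \<in> X'"
  shows "{u, v} \<in> insert_ribbon x y a P \<longleftrightarrow>
    {u, v} = {a, x} \<or> {u, v} = {mate P a, y} \<or>
    (u \<in> X' \<and> u \<noteq> a \<and> u \<noteq> mate P a \<and> v = mate P u)"
  using assms unfolding insert_ribbon_def
  by (auto simp: doubleton_eq_iff pair_iff[OF P] mate_mate[OF P])

lemma pairing_insert_ribbon:
  assumes a: "a \<in> X'"
  shows "pairing_on (insert x (insert y X')) (insert_ribbon x y a P)"
proof (rule pairing_onI)
  note m = mate_mem[OF P] mate_neq[OF P]
  fix p assume "p \<in> insert_ribbon x y a P"
  then consider "p = {a, x}" | "p = {mate P a, y}" | "p \<in> P" unfolding insert_ribbon_def by auto
  then show "\<exists>a b. a \<in> insert x (insert y X') \<and> b \<in> insert x (insert y X') \<and> a \<noteq> b \<and> p = {a, b}"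
  proof cases
    case 1
    have "a \<noteq> x" using a new by auto
    then show ?thesis using a 1 by blast
  next
    case 2
    have "mate P a \<noteq> y" using m(1)[OF a] new by auto
    then show ?thesis using m(1)[OF a] 2 by blast
  next
    case 3 then show ?thesis using pairing_cases[OF P] m by (metis insertI2)
  qed
next
  fix u assume "u \<in> insert x (insert y X')"
  then consider "u = x" | "u = y" | "u = a" | "u = mate P a"
    | "u \<in> X'" "u \<noteq> a" "u \<noteq> mate P a" by blast
  then show "\<exists>b. {u, b} \<in> insert_ribbon x y a P"
    unfolding pair_insert_ribbon_iff[OF a] by cases (auto simp: doubleton_eq_iff)
next
  fix u b c assume "{u, b} \<in> insert_ribbon x y a P" "{u, c} \<in> insert_ribbon x y a P"
  then show "b = c"
    unfolding pair_insert_ribbon_iff[OF a] using new a mate_mem[OF P a] mate_neq[OF P a]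
    by (auto simp: doubleton_eq_iff)
qed

lemma merge_insert_ribbon:
  assumes a: "a \<in> X'"
  shows "merge_corners {x, y} (insert_ribbon x y a P) = P"
proof -
  note b = mate_mem[OF P a] mate_neq[OF P a]
  have "p \<inter> {x, y} = {}" if "p \<in> P" for p using that pairing_Union[OF P] new by blast
  then have "{p \<in> insert_ribbon x y a P. p \<inter> {x, y} = {}} = P - {{a, mate P a}}"
    unfolding insert_ribbon_def by auto
  moreover have "{{u, v} | u v x' y'. {x, y} = {x', y'} \<and> {u, x'} \<in> insert_ribbon x y a P \<and>
      {v, y'} \<in> insert_ribbon x y a P \<and> u \<notin> {x, y} \<and> v \<notin> {x, y}} = {{a, mate P a}}"
    (is "?L = _")
  proof
    show "?L \<subseteq> {{a, mate P a}}"
      unfolding pair_insert_ribbon_iff[OF a] using new a b mate_mem[OF P]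
      by (auto simp: doubleton_eq_iff)
    have "{a, x} \<in> insert_ribbon x y a P" "{mate P a, y} \<in> insert_ribbon x y a P"
      unfolding insert_ribbon_def by auto
    then show "{{a, mate P a}} \<subseteq> ?L" using new a b by fastforce
  qed
  ultimately show ?thesis unfolding merge_corners_def using mate_pair[OF P a] by auto
qed

lemma mate_insert_ribbon:
  assumes "a \<in> X'" shows "mate (insert_ribbon x y a P) x = a"
  using mate_eq_iff[OF pairing_insert_ribbon[OF assms], of x a]
  by (simp add: insert_ribbon_def insert_commute)

end

text \<open>Deletion has no other preimages than the two insertions: if \<open>x\<close> and
  \<open>y\<close> form a corner, they bound a vertex of degree 1; otherwise the partner of
  \<open>x\<close> is the side \<open>a\<close>, and \<open>a\<close> together with the smaller
  pairing determines \<open>P\<close>.\<close>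

lemma merge_corners_cases:
  assumes P: "pairing_on (insert x (insert y X')) P"
  defines "P' \<equiv> merge_corners {x, y} P"
  shows "pairing_on X' P'"
    and "P = insert {x, y} P' \<or> (\<exists>a\<in>X'. P = insert_ribbon x y a P')"
proof -
  let ?X = "insert x (insert y X')"
  have eX: "x \<in> ?X" "y \<in> ?X" by auto
  have "pairing_on X' P' \<and> (P = insert {x, y} P' \<or> (\<exists>a\<in>X'. P = insert_ribbon x y a P'))"
  proof (cases "{x, y} \<in> P")
    case True
    \<comment> \<open>\<open>Q\<close> is a candidate for \<open>P'\<close>. Once it is a pairing
      from which inserting \<open>{x, y}\<close> gives back \<open>P\<close>,
      \<open>merge_insert_edge\<close> identifies it with \<open>P'\<close>, so the merged pairs
      need not be computed.\<close>
    define Q where "Q = P - {{x, y}}"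
    have PQ: "P = insert {x, y} Q" using True Q_def by auto
    have mx: "mate P x = y" "mate P y = x"
      using True mate_eq_iff[OF P] by (auto simp: insert_commute)
    have "pairing_on X' Q"
    proof (rule pairing_onI)
      fix p assume p: "p \<in> Q"
      then obtain a where a: "a \<in> ?X" "p = {a, mate P a}" using pairing_cases[OF P] Q_def by blast
      have "a \<noteq> x" "a \<noteq> y" using p a(2) mx Q_def by auto
      moreover from this have "mate P a \<noteq> x" "mate P a \<noteq> y"
        using mate_mate[OF P a(1)] mx by metis+
      ultimately have "a \<in> X' \<and> mate P a \<in> X' \<and> a \<noteq> mate P a \<and> p = {a, mate P a}"
        using a mate_mem[OF P a(1)] mate_neq[OF P a(1)] by auto
      then show "\<exists>a b. a \<in> X' \<and> b \<in> X' \<and> a \<noteq> b \<and> p = {a, b}" by blast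
    next
      fix a assume "a \<in> X'"
      then have "{a, mate P a} \<in> Q" using mate_pair[OF P] new Q_def by (auto simp: doubleton_eq_iff)
      then show "\<exists>b. {a, b} \<in> Q" by blast
    next
      fix a b c assume "{a, b} \<in> Q" "{a, c} \<in> Q"
      then show "b = c" using pair_iff[OF P] Q_def by auto
    qed
    then show ?thesis using merge_insert_edge P'_def PQ by metis
  next
    case False
    define a where "a = mate P x"
    define b where "b = mate P y"
    \<comment> \<open>The partners of the two deleted sides become partners of each other. Again
      \<open>P\<close> is rebuilt from \<open>Q\<close>, which identifies \<open>Q\<close> with
      \<open>P'\<close>.\<close>
    define Q where "Q = P - {{a, x}, {b, y}} \<union> {{a, b}}"
    note mm = mate_mate[OF P] and mn = mate_neq[OF P] and mX = mate_mem[OF P]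
    have abX: "a \<in> X'" "b \<in> X'" and ab: "a \<noteq> b"
      using False mX[OF eX(1)] mX[OF eX(2)] mn[OF eX(1)] mn[OF eX(2)] mm[OF eX(1)] mm[OF eX(2)]
        mate_pair[OF P eX(1)] mate_pair[OF P eX(2)] new
      unfolding a_def b_def by (auto simp: insert_commute)
    have ma: "mate P a = x" "mate P b = y" using mm eX a_def b_def by auto
    have Q_iff: "{u, v} \<in> Q \<longleftrightarrow> {u, v} = {a, b} \<or>
        (u \<in> X' \<and> u \<noteq> a \<and> u \<noteq> b \<and> v = mate P u)" for u v
      unfolding Q_def using ma abX a_def b_def new eX
      by (auto simp: doubleton_eq_iff pair_iff[OF P] mm)
    have mQ: "mate P u \<in> X'" if "u \<in> X'" "u \<noteq> a" "u \<noteq> b" for u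
      using that mX[of u] mm[of u] a_def b_def by auto
    have Q: "pairing_on X' Q"
    proof (rule pairing_onI)
      fix p assume p: "p \<in> Q"
      show "\<exists>a b. a \<in> X' \<and> b \<in> X' \<and> a \<noteq> b \<and> p = {a, b}"
      proof (cases "p = {a, b}")
        case True then show ?thesis using abX ab by blast
      next
        case False
        then obtain u where "u \<in> ?X" "p = {u, mate P u}" using p pairing_cases[OF P] Q_def by blast
        then have "u \<in> X' \<and> mate P u \<in> X' \<and> u \<noteq> mate P u \<and> p = {u, mate P u}"
          using Q_iff[of u "mate P u"] p False mQ mn[of u] by auto
        then show ?thesis by blast
      qed
    next
      fix u assume u: "u \<in> X'"
      then show "\<exists>v. {u, v} \<in> Q" unfolding Q_iff by (auto simp: doubleton_eq_iff)
    next
      fix u v w assume "{u, v} \<in> Q" "{u, w} \<in> Q"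
      then show "v = w" unfolding Q_iff using ab by (auto simp: doubleton_eq_iff)
    qed
    have mQa: "mate Q a = b" using mate_eq_iff[OF Q abX(1)] Q_def by auto
    have "{a, b} \<notin> P" using pair_iff[OF P] ma abX new by auto
    moreover have "{a, x} \<in> P" "{b, y} \<in> P" using pair_iff[OF P] ma abX by auto
    ultimately have "P = insert_ribbon x y a Q"
      unfolding insert_ribbon_def mQa using abX new ab
      by (auto simp: Q_def doubleton_eq_iff)
    then show ?thesis using merge_insert_ribbon[OF Q abX(1)] P'_def Q abX by metis
  qed
  then show "pairing_on X' P'" "P = insert {x, y} P' \<or> (\<exists>a\<in>X'. P = insert_ribbon x y a P')"
    by auto
qed

end

subsection \<open>Invariants and orientations\<close>

text \<open>Up to values outside \<open>\<Union>P\<close>, these are the characteristic functions of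
  unions of orbits. They stand in for the orbit partition because uniting sets of pairs becomes
  intersecting sets of functions, and a single function refutes connectivity.\<close>

definition invariants :: "'a set set \<Rightarrow> ('a \<Rightarrow> bool) set" where
  "invariants P = {f. \<forall>p\<in>P. \<forall>u\<in>p. \<forall>v\<in>p. f u = f v}"

text \<open>For corners this is an orientation of the polygons, for edges it is coherence of the
  gluing; a map is orientable iff one \<open>d\<close> serves all three pairings.\<close>

definition alternating :: "'a set set \<Rightarrow> ('a \<Rightarrow> bool) \<Rightarrow> bool" where
  "alternating P d \<longleftrightarrow> (\<forall>u v. u \<noteq> v \<and> {u, v} \<in> P \<longrightarrow> d u \<noteq> d v)"

lemma invariantsD: "f \<in> invariants P \<Longrightarrow> p \<in> P \<Longrightarrow> u \<in> p \<Longrightarrow> v \<in> p \<Longrightarrow> f u = f v"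
  unfolding invariants_def by blast

lemma invariants_pairD: "f \<in> invariants P \<Longrightarrow> {u, v} \<in> P \<Longrightarrow> f u = f v"
  by (rule invariantsD[where p = "{u, v}"]) simp_all

lemma invariants_Un: "invariants (P \<union> Q) = invariants P \<inter> invariants Q"
  by (auto simp: invariants_def)

lemma invariants_insert_pair:
  "f \<in> invariants (insert {u, v} P) \<longleftrightarrow> f u = f v \<and> f \<in> invariants P"
  by (auto simp: invariants_def)

lemma invariants_cong:
  assumes "\<And>z. z \<in> \<Union>P \<Longrightarrow> f z = g z"
  shows "f \<in> invariants P \<longleftrightarrow> g \<in> invariants P"
proof -
  have "f u = g u" if "p \<in> P" "u \<in> p" for p u using that assms by blast
  then show ?thesis unfolding invariants_def by simp
qed

lemma alternating_Un: "alternating (P \<union> Q) d \<longleftrightarrow> alternating P d \<and> alternating Q d"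
  unfolding alternating_def by blast

lemma alternating_cong:
  assumes "\<And>z. z \<in> \<Union>P \<Longrightarrow> f z = g z"
  shows "alternating P f \<longleftrightarrow> alternating P g"
proof -
  have "f u = g u \<and> f v = g v" if "{u, v} \<in> P" for u v using that assms by blast
  then show ?thesis unfolding alternating_def by metis
qed

text \<open>The orientation is reversed on the union of orbits selected by \<open>h\<close>.\<close>

lemma alternating_flip:
  assumes "alternating P d" "h \<in> invariants P"
  shows "alternating P (\<lambda>z. d z \<noteq> h z)"
proof -
  have "h u = h v" if "{u, v} \<in> P" for u v
    using that assms(2) invariants_pairD by metis
  then show ?thesis using assms(1) unfolding alternating_def by metis
qed

text \<open>Both orientations change within each pair, so their agreement does not: on a connected
  set an orientation is determined up to reversal.\<close>

lemma invariants_alternating_eq: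
  assumes "pairing_on X P" "alternating P d" "alternating P d'"
  shows "(\<lambda>z. d z = d' z) \<in> invariants P"
  unfolding invariants_def
proof (intro CollectI ballI)
  fix p u v assume "p \<in> P" "u \<in> p" "v \<in> p"
  moreover from this obtain a where "a \<in> X" "p = {a, mate P a}"
    using pairing_cases[OF assms(1)] by metis
  moreover have "d a \<noteq> d (mate P a)" "d' a \<noteq> d' (mate P a)" if "a \<in> X"
    using assms(2,3) mate_pair[OF assms(1) that] mate_neq[OF assms(1) that]
    unfolding alternating_def by metis+
  ultimately show "(d u = d' u) = (d v = d' v)" by auto
qed

context
  fixes X :: "'a set" and P :: "'a set set"
  assumes P: "pairing_on X P"
begin

lemma invariants_minus_pair_iff:
  assumes a: "a \<in> X"
  shows "f \<in> invariants (P - {{a, mate P a}}) \<longleftrightarrow>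
    (\<forall>u\<in>X. u \<noteq> a \<longrightarrow> u \<noteq> mate P a \<longrightarrow> f (mate P u) = f u)"
proof
  assume f: "f \<in> invariants (P - {{a, mate P a}})"
  show "\<forall>u\<in>X. u \<noteq> a \<longrightarrow> u \<noteq> mate P a \<longrightarrow> f (mate P u) = f u"
  proof (intro ballI impI)
    fix u assume "u \<in> X" "u \<noteq> a" "u \<noteq> mate P a"
    then have "{u, mate P u} \<in> P - {{a, mate P a}}"
      using mate_pair[OF P] by (auto simp: doubleton_eq_iff)
    then show "f (mate P u) = f u" using invariants_pairD[OF f] by metis
  qed
next
  assume *: "\<forall>u\<in>X. u \<noteq> a \<longrightarrow> u \<noteq> mate P a \<longrightarrow> f (mate P u) = f u"
  show "f \<in> invariants (P - {{a, mate P a}})" unfolding invariants_def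
  proof (intro CollectI ballI)
    fix p u v assume p: "p \<in> P - {{a, mate P a}}" "u \<in> p" "v \<in> p"
    obtain w where w: "w \<in> X" "p = {w, mate P w}" using pairing_cases[OF P] p(1) by blast
    have "w \<noteq> a" "w \<noteq> mate P a" using p(1) w mate_mate[OF P a] by auto
    then have "f (mate P w) = f w" using * w(1) by blast
    then show "f u = f v" using p w(2) by auto
  qed
qed

lemma invariants_iff: "f \<in> invariants P \<longleftrightarrow> (\<forall>u\<in>X. f (mate P u) = f u)"
proof
  assume f: "f \<in> invariants P"
  show "\<forall>u\<in>X. f (mate P u) = f u"
  proof
    fix u assume "u \<in> X"
    from mate_pair[OF P this] show "f (mate P u) = f u" using invariants_pairD[OF f] by metis
  qed
next
  assume *: "\<forall>u\<in>X. f (mate P u) = f u"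
  show "f \<in> invariants P" unfolding invariants_def
  proof (intro CollectI ballI)
    fix p u v assume p: "p \<in> P" "u \<in> p" "v \<in> p"
    obtain w where w: "w \<in> X" "p = {w, mate P w}" using pairing_cases[OF P] p(1) by blast
    then show "f u = f v" using p * by auto
  qed
qed

lemma invariants_iff_imp: "f \<in> invariants P \<longleftrightarrow> (\<forall>u\<in>X. f u \<longrightarrow> f (mate P u))"
  unfolding invariants_iff using mate_mem[OF P] mate_mate[OF P] by metis

lemma alternating_iff: "alternating P d \<longleftrightarrow> (\<forall>u\<in>X. d (mate P u) = (\<not> d u))"
  unfolding alternating_def pair_iff[OF P] using mate_neq[OF P] by metis

end

context
  fixes x y :: 'a and X' :: "'a set" and P :: "'a set set" and a :: 'a
  assumes new: "x \<noteq> y" "x \<notin> X'" "y \<notin> X'"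
    and P: "pairing_on X' P" and a: "a \<in> X'"
begin

lemma invariants_insert_ribbon_iff:
  "f \<in> invariants (insert_ribbon x y a P) \<longleftrightarrow> f a = f x \<and> f (mate P a) = f y \<and>
    (\<forall>u\<in>X'. u \<noteq> a \<longrightarrow> u \<noteq> mate P a \<longrightarrow> f (mate P u) = f u)"
  unfolding invariants_minus_pair_iff[OF P a, symmetric] insert_ribbon_def
  by (auto simp: invariants_insert_pair)

text \<open>If both sides of the ribbon get the same value, then \<open>a\<close>, \<open>x\<close>,
  \<open>y\<close> and \<open>mate P a\<close> all agree and the ribbon is invisible: apart from the
  value at \<open>x\<close>, the condition is that of the unsplit corner.\<close>

lemma invariants_insert_ribbon_eq_iff:
  assumes "f x = f y"
  shows "f \<in> invariants (insert_ribbon x y a P) \<longleftrightarrow> f a = f x \<and> f \<in> invariants P"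
proof -
  have "f \<in> invariants P \<longleftrightarrow> f (mate P a) = f a \<and>
      (\<forall>u\<in>X'. u \<noteq> a \<longrightarrow> u \<noteq> mate P a \<longrightarrow> f (mate P u) = f u)"
    unfolding invariants_iff[OF P] using a mate_mate[OF P a] by auto
  then show ?thesis unfolding invariants_insert_ribbon_iff using assms by auto
qed

lemma alternating_insert_ribbon_iff:
  "alternating (insert_ribbon x y a P) d \<longleftrightarrow> d a \<noteq> d x \<and> d (mate P a) \<noteq> d y \<and>
    (\<forall>u\<in>X'. u \<noteq> a \<longrightarrow> u \<noteq> mate P a \<longrightarrow> d (mate P u) = (\<not> d u))"
proof
  note iff = pair_insert_ribbon_iff[OF new P a]
  assume d: "alternating (insert_ribbon x y a P) d"
  have "a \<noteq> x" "mate P a \<noteq> y" using a new mate_mem[OF P a] by auto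
  moreover have "d (mate P u) = (\<not> d u)" if "u \<in> X'" "u \<noteq> a" "u \<noteq> mate P a" for u
  proof -
    have "{u, mate P u} \<in> insert_ribbon x y a P" unfolding iff using that by simp
    then show ?thesis using d mate_neq[OF P that(1)] unfolding alternating_def by metis
  qed
  moreover have "{a, x} \<in> insert_ribbon x y a P" "{mate P a, y} \<in> insert_ribbon x y a P"
    unfolding iff by simp_all
  ultimately show "d a \<noteq> d x \<and> d (mate P a) \<noteq> d y \<and>
      (\<forall>u\<in>X'. u \<noteq> a \<longrightarrow> u \<noteq> mate P a \<longrightarrow> d (mate P u) = (\<not> d u))"
    using d unfolding alternating_def by blast
next
  assume "d a \<noteq> d x \<and> d (mate P a) \<noteq> d y \<and>
      (\<forall>u\<in>X'. u \<noteq> a \<longrightarrow> u \<noteq> mate P a \<longrightarrow> d (mate P u) = (\<not> d u))"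
  then show "alternating (insert_ribbon x y a P) d"
    unfolding alternating_def pair_insert_ribbon_iff[OF new P a] doubleton_eq_iff by auto
qed

text \<open>With opposite values on \<open>x\<close> and \<open>y\<close> the sequence
  \<open>a\<close>, \<open>x\<close>, \<open>y\<close>, \<open>mate P a\<close> alternates, so the
  sides of the split corner still get opposite values.\<close>

lemma alternating_insert_ribbon_neq_iff:
  assumes "d x \<noteq> d y"
  shows "alternating (insert_ribbon x y a P) d \<longleftrightarrow> d a \<noteq> d x \<and> alternating P d"
proof -
  have "alternating P d \<longleftrightarrow> d (mate P a) \<noteq> d a \<and>
      (\<forall>u\<in>X'. u \<noteq> a \<longrightarrow> u \<noteq> mate P a \<longrightarrow> d (mate P u) = (\<not> d u))"
    unfolding alternating_iff[OF P] using a mate_mate[OF P a] by auto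
  then show ?thesis unfolding alternating_insert_ribbon_iff using assms by auto
qed

end

lemma alternating_insert_pair:
  assumes "u \<noteq> v"
  shows "alternating (insert {u, v} P) d \<longleftrightarrow> d u \<noteq> d v \<and> alternating P d"
  using assms unfolding alternating_def insert_iff doubleton_eq_iff by auto

section \<open>Orbits, top degree and orientability in terms of Boolean functions\<close>

lemma equiv_linked: "equiv (\<Union>P) ((linked P)\<^sup>+)"
proof (rule equivI)
  have "linked P \<subseteq> \<Union>P \<times> \<Union>P" unfolding linked_def by auto
  then show "(linked P)\<^sup>+ \<subseteq> \<Union>P \<times> \<Union>P" by (rule trancl_subset_Sigma)
  show "refl_on (\<Union>P) ((linked P)\<^sup>+)"
    unfolding refl_on_def linked_def by (auto intro!: r_into_trancl)
  have "sym (linked P)" unfolding sym_def linked_def by auto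
  then show "sym ((linked P)\<^sup>+)" by (rule sym_trancl)
qed simp

lemma linked_trancl_iff:
  "(u, v) \<in> (linked P)\<^sup>+ \<longleftrightarrow> u \<in> \<Union>P \<and> v \<in> \<Union>P \<and> (\<forall>f\<in>invariants P. f u = f v)"
proof
  assume uv: "(u, v) \<in> (linked P)\<^sup>+"
  have "f u = f v" if "f \<in> invariants P" for f
    using uv
  proof induction
    case (base z) then show ?case using invariantsD[OF that] unfolding linked_def by auto
  next
    case (step z z')
    then have "f z = f z'" using invariantsD[OF that] unfolding linked_def by auto
    then show ?case using step by simp
  qed
  then show "u \<in> \<Union>P \<and> v \<in> \<Union>P \<and> (\<forall>f\<in>invariants P. f u = f v)"
    using uv equiv_type[OF equiv_linked[of P]] by auto
next
  assume *: "u \<in> \<Union>P \<and> v \<in> \<Union>P \<and> (\<forall>f\<in>invariants P. f u = f v)"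
  \<comment> \<open>The indicator of the orbit of \<open>u\<close> is the invariant that would
    separate \<open>v\<close> from \<open>u\<close>.\<close>
  let ?f = "\<lambda>z. (u, z) \<in> (linked P)\<^sup>+"
  have "?f \<in> invariants P" unfolding invariants_def
  proof (intro CollectI ballI)
    fix p z z' assume "p \<in> P" "z \<in> p" "z' \<in> p"
    then have "(z, z') \<in> linked P" "(z', z) \<in> linked P" unfolding linked_def by auto
    then show "?f z = ?f z'" by (metis trancl.trancl_into_trancl)
  qed
  then have "?f u = ?f v" using bspec[OF conjunct2[OF conjunct2[OF *]], of ?f] by simp
  moreover have "?f u" using * equiv_linked[of P] unfolding equiv_def refl_on_def by blast
  ultimately show "(u, v) \<in> (linked P)\<^sup>+" by simp
qed

lemma orbits_cong:
  assumes "\<Union>P = \<Union>Q" "invariants P = invariants Q"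
  shows "orbits P = orbits Q"
proof -
  have "(linked P)\<^sup>+ = (linked Q)\<^sup>+" using linked_trancl_iff[of _ _ P] linked_trancl_iff[of _ _ Q] assms by auto
  then show ?thesis unfolding orbits_def using assms(1) by simp
qed

text \<open>Faces refine components, so having one face in each component means that the two
  partitions coincide: the edges connect nothing that the corners do not connect already.\<close>

lemma top_degree_iff:
  assumes "nonoriented_map X (Bimap B W E)"
  shows "top_degree (Bimap B W E) \<longleftrightarrow> invariants B \<inter> invariants W \<subseteq> invariants E"
proof -
  have U: "\<Union>B = X" "\<Union>W = X" "\<Union>E = X"
    using assms pairing_Union unfolding nonoriented_map_def by auto
  define R where "R = (linked (B \<union> W))\<^sup>+"
  define S where "S = (linked (B \<union> W \<union> E))\<^sup>+"
  have R: "equiv X R" and S: "equiv X S"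
    using equiv_linked[of "B \<union> W"] equiv_linked[of "B \<union> W \<union> E"] U unfolding R_def S_def by auto
  have R_iff: "(u, v) \<in> R \<longleftrightarrow> u \<in> X \<and> v \<in> X \<and> (\<forall>f\<in>invariants B \<inter> invariants W. f u = f v)" for u v
    unfolding R_def linked_trancl_iff using U by (auto simp: invariants_Un)
  have S_iff: "(u, v) \<in> S \<longleftrightarrow> u \<in> X \<and> v \<in> X \<and>
      (\<forall>f\<in>invariants B \<inter> invariants W \<inter> invariants E. f u = f v)" for u v
    unfolding S_def linked_trancl_iff using U by (auto simp: invariants_Un)
  have RS: "R \<subseteq> S" using R_iff S_iff by auto
  have top: "top_degree (Bimap B W E) \<longleftrightarrow> (\<forall>C\<in>X // S. \<exists>!F. F \<in> X // R \<and> F \<subseteq> C)"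
    unfolding top_degree_def components_def faces_def orbits_def R_def S_def using U by simp
  show ?thesis
  proof
    assume "top_degree (Bimap B W E)"
    then have uniq: "\<And>C F F'. C \<in> X // S \<Longrightarrow> F \<in> X // R \<Longrightarrow> F \<subseteq> C \<Longrightarrow> F' \<in> X // R \<Longrightarrow> F' \<subseteq> C \<Longrightarrow> F = F'"
      unfolding top by blast
    show "invariants B \<inter> invariants W \<subseteq> invariants E"
    proof
      fix f assume f: "f \<in> invariants B \<inter> invariants W"
      show "f \<in> invariants E" unfolding invariants_def
      proof (intro CollectI ballI)
        fix p u v assume p: "p \<in> E" "u \<in> p" "v \<in> p"
        have uX: "u \<in> X" "v \<in> X" using p U by auto
        have uv: "(u, v) \<in> S" unfolding S_iff using uX invariantsD p by (metis IntD2)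
        then have "R `` {v} \<subseteq> S `` {u}" using RS S by (metis Image_mono equiv_class_eq subset_refl)
        moreover have "R `` {u} \<subseteq> S `` {u}" using RS by blast
        ultimately have "R `` {u} = R `` {v}"
          using uniq[of "S `` {u}"] uX by (meson quotientI)
        then have "(u, v) \<in> R" using R uX by (metis eq_equiv_class)
        then show "f u = f v" using f R_iff by blast
      qed
    qed
  next
    assume "invariants B \<inter> invariants W \<subseteq> invariants E"
    then have "invariants B \<inter> invariants W \<inter> invariants E = invariants B \<inter> invariants W" by auto
    then have SR: "S = R" using R_iff S_iff by (intro set_eqI) (simp only: split_paired_all)
    show "top_degree (Bimap B W E)" unfolding top SR
    proof (intro ballI ex1I conjI)
      fix C F assume C: "C \<in> X // R" and F: "F \<in> X // R \<and> F \<subseteq> C"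
      then have "F \<noteq> {}" using R in_quotient_imp_non_empty by blast
      then show "F = C" using C F R quotient_disj by blast
    qed auto
  qed
qed

lemma orientable_iff:
  "orientable (Bimap B W E) \<longleftrightarrow> (\<exists>d. alternating B d \<and> alternating W d \<and> alternating E d)"
  unfolding orientable_def boundary_orientation_def 
    bimap.sel alternating_def[symmetric] alternating_Un conj_assoc ..

section \<open>Orienting a polygon and walking around it\<close>

text \<open>Black and white corners alternate around a polygon, so its number of sides is even. The
  induction deletes the two sides at a black corner, which shortens their polygon by two sides or
  removes it if it is a 2-gon.\<close>

lemma ex_alternating:
  assumes "finite X" "pairing_on X B" "pairing_on X W"
  shows "\<exists>d. alternating B d \<and> alternating W d"
  using assms
proof (induction "card X" arbitrary: X B W rule: less_induct)
  case less
  show ?case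
  proof (cases "X = {}")
    case True
    then have "alternating B d" "alternating W d" for d
      using alternating_iff less.prems(2,3) by blast+
    then show ?thesis by blast
  next
    case False
    then obtain x where x: "x \<in> X" by blast
    define y where "y = mate B x"
    define X' where "X' = X - {x, y}"
    have y: "y \<in> X" "x \<noteq> y" "{x, y} \<in> B"
      using mate_mem[OF less.prems(2) x] mate_neq[OF less.prems(2) x] mate_pair[OF less.prems(2) x]
      unfolding y_def by auto
    have X: "X = insert x (insert y X')" and new: "x \<noteq> y" "x \<notin> X'" "y \<notin> X'"
      using x y X'_def by auto
    define B' where "B' = merge_corners {x, y} B"
    define W' where "W' = merge_corners {x, y} W"
    note cB = merge_corners_cases[OF new less.prems(2)[unfolded X], folded B'_def]
    note cW = merge_corners_cases[OF new less.prems(3)[unfolded X], folded W'_def]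
    have "{x, y} \<notin> insert_ribbon x y a B'" if "a \<in> X'" for a
      unfolding pair_insert_ribbon_iff[OF new cB(1) that] using new that mate_mem[OF cB(1) that]
      by (auto simp: doubleton_eq_iff)
    then have B: "B = insert {x, y} B'" using cB(2) y(3) by blast
    have "card X' < card X" "finite X'" using less.prems(1) x unfolding X'_def
      by (auto intro: psubset_card_mono)
    then obtain d where d: "alternating B' d" "alternating W' d"
      using less.hyps cB(1) cW(1) by blast
    have cong: "alternating P (d(x := s, y := t)) = alternating P d" if "pairing_on X' P" for P s t
      by (rule alternating_cong) (use pairing_Union[OF that] new in auto)
    from cW(2) show ?thesis
    proof
      assume "W = insert {x, y} W'"
      then have "alternating B (d(x := True, y := False)) \<and> alternating W (d(x := True, y := False))"
        unfolding B using d new cong[OF cB(1)] cong[OF cW(1)] by (simp add: alternating_insert_pair)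
      then show ?thesis by blast
    next
      assume "\<exists>a\<in>X'. W = insert_ribbon x y a W'"
      then obtain a where a: "a \<in> X'" "W = insert_ribbon x y a W'" by blast
      \<comment> \<open>\<open>x\<close> must oppose its white neighbour \<open>a\<close>; then
        \<open>y\<close>, opposite to \<open>x\<close>, also opposes the partner of \<open>a\<close>
        in \<open>W'\<close>, whose value is \<open>\<not> d a\<close>.\<close>
      let ?d = "d(x := \<not> d a, y := d a)"
      have "alternating B ?d \<and> alternating W ?d"
        unfolding B a(2) using d new cong[OF cB(1)] cong[OF cW(1)] a(1)
        by (auto simp: alternating_insert_pair alternating_insert_ribbon_neq_iff[OF new cW(1) a(1)])
      then show ?thesis by blast
    qed
  qed
qed

context
  fixes X :: "'a set" and B W :: "'a set set"
  assumes finite: "finite X" and B: "pairing_on X B" and W: "pairing_on X W"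
begin

text \<open>Crosses a white and then a black corner: two sides further along the polygon, hence with
  the same direction as before.\<close>

private abbreviation "s \<equiv> \<lambda>z. mate B (mate W z)"

lemma walk_mem: "a \<in> X \<Longrightarrow> (s ^^ i) a \<in> X"
  using mate_mem[OF B] mate_mem[OF W] by (induction i) auto

text \<open>\<open>s\<close> is injective on the finite set \<open>X\<close>, so a repetition in the
  walk can be pulled back to its start.\<close>

lemma walk_periodic:
  assumes "a \<in> X" shows "\<exists>k>0. (s ^^ k) a = a"
proof -
  have cancel: "(s ^^ i) a = a" if "(s ^^ (i + j)) a = (s ^^ j) a" for i j
    using that
  proof (induction j)
    case (Suc j)
    have inv: "mate W (mate B (s z)) = z" if "z \<in> X" for z
      using that by (simp add: mate_mate[OF B] mate_mate[OF W] mate_mem[OF W])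
    have eq: "s ((s ^^ (i + j)) a) = s ((s ^^ j) a)" using Suc.prems by simp
    have "(s ^^ (i + j)) a = (s ^^ j) a"
      using inv[OF walk_mem[OF assms, of "i + j"]] inv[OF walk_mem[OF assms, of j]]
      unfolding eq by (rule box_equals[OF refl])
    then show ?case by (rule Suc.IH)
  qed auto
  have "\<not> inj (\<lambda>i. (s ^^ i) a)"
  proof
    assume "inj (\<lambda>i. (s ^^ i) a)"
    moreover have "finite (range (\<lambda>i. (s ^^ i) a))"
      using walk_mem[OF assms] finite by (auto intro: finite_subset)
    ultimately show False using finite_imageD by blast
  qed
  then obtain i j where "i < j" "(s ^^ i) a = (s ^^ j) a"
    unfolding inj_def by (metis linorder_neqE_nat)
  then have "(s ^^ ((j - i) + i)) a = (s ^^ i) a" "j - i > 0" by auto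
  then show ?thesis using cancel by blast
qed

text \<open>The hypotheses stop at \<open>k\<close> because \<open>f\<close> will be an invariant of
  a map in which a ribbon has opened two corners; its constancy along the walk is guaranteed only
  while neither is crossed.\<close>

lemma walk_const:
  assumes "\<And>i. i < k \<Longrightarrow> f (mate W ((s ^^ i) a)) = f ((s ^^ i) a)"
    and "\<And>i. i < k \<Longrightarrow> f (mate B (mate W ((s ^^ i) a))) = f (mate W ((s ^^ i) a))"
  shows "f ((s ^^ k) a) = f a"
  using assms by (induction k) auto

lemma walk_alternating:
  assumes "a \<in> X" "alternating B d" "alternating W d"
  shows "d ((s ^^ i) a) = d a" "d (mate W ((s ^^ i) a)) = (\<not> d a)"
proof -
  have *: "d (mate B (mate W z)) = d z" "d (mate W z) = (\<not> d z)" if "z \<in> X" for z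
    using that assms(2,3) alternating_iff[OF B] alternating_iff[OF W] mate_mem[OF W] by auto
  show "d ((s ^^ i) a) = d a" using * walk_mem[OF assms(1)] by (induction i) auto
  then show "d (mate W ((s ^^ i) a)) = (\<not> d a)" using * walk_mem[OF assms(1)] by simp
qed

lemma walk_invariant:
  assumes "a \<in> X" "h \<in> invariants B" "h \<in> invariants W"
  shows "h ((s ^^ i) a) = h a" "h (mate W ((s ^^ i) a)) = h a"
proof -
  have *: "h (mate B (mate W z)) = h z" "h (mate W z) = h z" if "z \<in> X" for z
    using that assms(2,3) invariants_iff[OF B] invariants_iff[OF W] mate_mem[OF W] by auto
  show "h ((s ^^ i) a) = h a" using * walk_mem[OF assms(1)] by (induction i) auto
  then show "h (mate W ((s ^^ i) a)) = h a" using * walk_mem[OF assms(1)] by simp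
qed

text \<open>The sides of the polygon of \<open>a\<close> are the points of the walk and their white
  partners. The latter have the opposite direction, so \<open>d a' = d a\<close> puts
  \<open>a'\<close> on the walk itself.\<close>

lemma walk_reaches:
  assumes a: "a \<in> X" and a': "a' \<in> X" and d: "alternating B d" "alternating W d" "d a' = d a"
    and conn: "\<And>f. f \<in> invariants B \<Longrightarrow> f \<in> invariants W \<Longrightarrow> f a = f a'"
  shows "\<exists>k. (s ^^ k) a = a' \<and> (\<forall>i<k. (s ^^ i) a \<noteq> a')"
proof -
  obtain m where m: "m > 0" "(s ^^ m) a = a" using walk_periodic[OF a] by blast
  \<comment> \<open>Periodicity supplies a predecessor of the start as well; without it the visited
    sides would not be closed under black corners.\<close>
  have pred: "\<exists>j. (s ^^ i) a = s ((s ^^ j) a)" for i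
  proof (cases i)
    case 0
    then show ?thesis using m by (intro exI[of _ "m - 1"]) (cases m, auto)
  qed auto
  define f where "f z \<longleftrightarrow> (\<exists>i. z = (s ^^ i) a) \<or> (\<exists>i. z = mate W ((s ^^ i) a))" for z
  have "f \<in> invariants W"
    unfolding invariants_iff_imp[OF W] f_def using mate_mate[OF W] walk_mem[OF a] by metis
  moreover have "f \<in> invariants B"
    unfolding invariants_iff_imp[OF B]
  proof (intro ballI impI)
    fix u assume "u \<in> X" "f u"
    then consider i where "u = (s ^^ i) a" | i where "u = mate W ((s ^^ i) a)" unfolding f_def by blast
    then show "f (mate B u)"
    proof cases
      case 1
      then obtain j where "u = mate B (mate W ((s ^^ j) a))" using pred by blast
      then show ?thesis unfolding f_def using mate_mate[OF B] mate_mem[OF W] walk_mem[OF a] by metis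
    next
      case 2
      then have "mate B u = (s ^^ Suc i) a" by simp
      then show ?thesis unfolding f_def by blast
    qed
  qed
  ultimately have "f a = f a'" by (rule conn[rotated])
  moreover have "f a" unfolding f_def by (metis funpow_0)
  ultimately have "\<exists>i. (s ^^ i) a = a'"
    unfolding f_def using walk_alternating[OF a d(1,2)] d(3) by metis
  then show ?thesis using exists_least_iff[of "\<lambda>i. (s ^^ i) a = a'"] by auto
qed

end

subsection \<open>Counting the extensions of a map by one edge\<close>

locale edge_insertion =
  fixes x y :: 'a and X' :: "'a set" and E' :: "'a set set"
  assumes new: "x \<noteq> y" "x \<notin> X'" "y \<notin> X'"
    and finite: "finite X'" and E': "pairing_on X' E'"
begin

abbreviation "X \<equiv> insert x (insert y X')"
abbreviation "E \<equiv> insert {x, y} E'"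

text \<open>Invariants are unconstrained outside the union of their pairs. Passing to the sides that
  remain after deletion therefore amounts to freeing the values at \<open>x\<close> and
  \<open>y\<close>.\<close>

definition forget :: "('a \<Rightarrow> bool) set \<Rightarrow> ('a \<Rightarrow> bool) set" where
  "forget I = {f. \<exists>g\<in>I. \<forall>z. z \<noteq> x \<longrightarrow> z \<noteq> y \<longrightarrow> f z = g z}"

text \<open>For \<open>I = invariants (P \<union> E)\<close> these are the sides other than \<open>x\<close> and \<open>y\<close> around the vertex
  containing the edge \<open>{x, y}\<close>, hence the possible partners of \<open>x\<close> in \<open>P\<close>.\<close>

definition partners :: "('a \<Rightarrow> bool) set \<Rightarrow> 'a set" where
  "partners I = {a \<in> X'. \<forall>f\<in>I. f a = f x}"

lemma finite_partners: "finite (partners I)"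
  using finite unfolding partners_def by simp

lemma invariants_upd:
  assumes "pairing_on X' P"
  shows "f(x := s, y := t) \<in> invariants P \<longleftrightarrow> f \<in> invariants P"
  by (rule invariants_cong) (use pairing_Union[OF assms] new in auto)

lemma alternating_upd:
  assumes "pairing_on X' P"
  shows "alternating P (f(x := s, y := t)) \<longleftrightarrow> alternating P f"
  by (rule alternating_cong) (use pairing_Union[OF assms] new in auto)

lemma invariants_edge_Un:
  assumes P': "pairing_on X' P'"
  shows "f \<in> invariants (insert {x, y} P' \<union> E) \<longleftrightarrow> f x = f y \<and> f \<in> invariants (P' \<union> E')"
  by (auto simp: invariants_Un invariants_insert_pair)

lemma invariants_ribbon_Un:
  assumes P': "pairing_on X' P'" and a: "a \<in> X'"
  shows "f \<in> invariants (insert_ribbon x y a P' \<union> E) \<longleftrightarrow>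
    f x = f y \<and> f a = f x \<and> f \<in> invariants (P' \<union> E')"
  using invariants_insert_ribbon_eq_iff[OF new P' a, of f]
  by (auto simp: invariants_Un invariants_insert_pair)

text \<open>The vertices of the smaller map depend only on those of the larger one, not on the
  arrangement of the sides around them, so the counting can recurse on
  \<open>forget I\<close>.\<close>

lemma forget_invariants:
  assumes P: "pairing_on X P"
  shows "invariants (merge_corners {x, y} P \<union> E') = forget (invariants (P \<union> E))"
proof -
  define P' where "P' = merge_corners {x, y} P"
  note c = merge_corners_cases[OF new P, folded P'_def]
  have upd: "f(x := s, y := t) \<in> invariants (P' \<union> E') \<longleftrightarrow> f \<in> invariants (P' \<union> E')" for f s t
    using invariants_upd[OF c(1)] invariants_upd[OF E'] by (simp add: invariants_Un)
  have forgetI: "f \<in> forget I" if "f(x := s, y := s) \<in> I" for f s I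
    unfolding forget_def by (intro CollectI bexI[OF _ that]) auto
  show ?thesis unfolding P'_def[symmetric]
  proof (intro equalityI subsetI)
    fix f assume f: "f \<in> invariants (P' \<union> E')"
    from c(2) show "f \<in> forget (invariants (P \<union> E))"
    proof
      assume P: "P = insert {x, y} P'"
      have "f(x := True, y := True) \<in> invariants (P \<union> E)"
        unfolding P invariants_edge_Un[OF c(1)] upd using f by simp
      then show ?thesis by (rule forgetI)
    next
      assume "\<exists>a\<in>X'. P = insert_ribbon x y a P'"
      then obtain a where a: "a \<in> X'" and P: "P = insert_ribbon x y a P'" by blast
      \<comment> \<open>The value at \<open>x\<close> and \<open>y\<close> is forced, since both lie
        at the vertex of \<open>a\<close>.\<close>
      have "f(x := f a, y := f a) \<in> invariants (P \<union> E)"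
        unfolding P invariants_ribbon_Un[OF c(1) a] upd using f a new by auto
      then show ?thesis by (rule forgetI)
    qed
  next
    fix f assume "f \<in> forget (invariants (P \<union> E))"
    then obtain g where g: "g \<in> invariants (P \<union> E)" "\<And>z. z \<noteq> x \<Longrightarrow> z \<noteq> y \<Longrightarrow> f z = g z"
      unfolding forget_def by blast
    have "f = g(x := f x, y := f y)" using g(2) by (intro ext) simp
    moreover have "g \<in> invariants (P' \<union> E')"
      using c(2) g(1) invariants_edge_Un[OF c(1)] invariants_ribbon_Un[OF c(1)] by blast
    ultimately show "f \<in> invariants (P' \<union> E')" using upd by metis
  qed
qed

context
  fixes P0 I P'
  assumes P0: "pairing_on X P0" and I: "I = invariants (P0 \<union> E)"
    and P': "pairing_on X' P'" and key: "invariants (P' \<union> E') = forget I"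
begin

text \<open>Partners lie at a single vertex of the smaller map, so connectivity conditions do not
  depend on which partner is taken.\<close>

lemma partners_const:
  assumes "a \<in> partners I" "b \<in> partners I" "f \<in> forget I"
  shows "f a = f b"
proof -
  obtain g where g: "g \<in> I" "\<And>z. z \<noteq> x \<Longrightarrow> z \<noteq> y \<Longrightarrow> f z = g z"
    using assms(3) unfolding forget_def by blast
  have "a \<noteq> x" "a \<noteq> y" "b \<noteq> x" "b \<noteq> y" using assms(1,2) new unfolding partners_def by auto
  moreover have "g a = g x" "g b = g x" using g(1) assms(1,2) unfolding partners_def by simp_all
  ultimately show ?thesis using g(2) by simp
qed

lemma mate_partners:
  assumes "a \<in> partners I" shows "mate P' a \<in> partners I"
proof -
  have a: "a \<in> X'" using assms unfolding partners_def by simp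
  have "f (mate P' a) = f x" if "f \<in> I" for f
  proof -
    have "f \<in> forget I" unfolding forget_def using that by blast
    then have "f \<in> invariants P'" unfolding key[symmetric] by (simp add: invariants_Un)
    then have "f (mate P' a) = f a" using invariants_iff[OF P'] a by blast
    then show ?thesis using assms that unfolding partners_def by simp
  qed
  then show ?thesis unfolding partners_def using mate_mem[OF P' a] by simp
qed

text \<open>The prescribed vertex leaves as neighbours of \<open>x\<close> exactly its partners:
  none means a new vertex of degree 1, and every partner yields the same vertex. The pairing
  \<open>P0\<close> guarantees that \<open>I\<close> is realised at all.\<close>

lemma extensions_eq:
  "{P. pairing_on X P \<and> merge_corners {x, y} P = P' \<and> invariants (P \<union> E) = I} =
    (if partners I = {} then {insert {x, y} P'} else (\<lambda>a. insert_ribbon x y a P') ` partners I)"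
proof -
  have I_forget: "f \<in> forget I" if "f \<in> I" for f unfolding forget_def using that by blast
  have I_xy: "f x = f y" if "f \<in> I" for f
    using that unfolding I by (simp add: invariants_Un invariants_insert_pair)
  have edge: "invariants (insert {x, y} P' \<union> E) = I" if "partners I = {}"
  proof -
    \<comment> \<open>A ribbon in \<open>P0\<close> would make its neighbour \<open>a\<close> a
      partner, so \<open>P0\<close> has the corner \<open>{x, y}\<close>, which computes
      \<open>I\<close>.\<close>
    define P0' where "P0' = merge_corners {x, y} P0"
    note c = merge_corners_cases[OF new P0, folded P0'_def]
    have "P0 \<noteq> insert_ribbon x y a P0'" if a: "a \<in> X'" for a
    proof
      assume "P0 = insert_ribbon x y a P0'"
      then have "a \<in> partners I"
        unfolding partners_def I using invariants_ribbon_Un[OF c(1) a] a by blast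
      then show False using \<open>partners I = {}\<close> by simp
    qed
    then have "P0 = insert {x, y} P0'" using c(2) by blast
    then have "I = {f. f x = f y \<and> f \<in> invariants (P0' \<union> E')}"
      unfolding I using invariants_edge_Un[OF c(1)] by blast
    then show ?thesis
      using invariants_edge_Un[OF P'] key forget_invariants[OF P0] unfolding P0'_def I by auto
  qed
  have no_edge: "partners I = {}" if eq: "invariants (insert {x, y} P' \<union> E) = I"
  proof (rule equals0I)
    fix a assume a: "a \<in> partners I"
    \<comment> \<open>Separates the degree-1 vertex \<open>{x, y}\<close> from all other
      sides.\<close>
    let ?f = "(\<lambda>z. True)(x := False, y := False)"
    have "(\<lambda>z. True) \<in> invariants (P' \<union> E')" unfolding invariants_def by simp
    then have "?f \<in> invariants (P' \<union> E')"
      using invariants_upd[OF P'] invariants_upd[OF E'] by (simp add: invariants_Un)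
    then have "?f \<in> I" unfolding eq[symmetric] invariants_edge_Un[OF P'] by simp
    then have "?f a = ?f x" "a \<in> X'" using a unfolding partners_def by blast+
    then show False using new by (auto split: if_splits)
  qed
  have ribbon: "invariants (insert_ribbon x y a P' \<union> E) = I" if a: "a \<in> partners I" for a
  proof -
    have aX: "a \<in> X'" using a unfolding partners_def by simp
    show ?thesis
    proof (intro equalityI subsetI)
      fix f assume "f \<in> invariants (insert_ribbon x y a P' \<union> E)"
      then have f: "f x = f y" "f a = f x" "f \<in> forget I"
        unfolding invariants_ribbon_Un[OF P' aX] key by auto
      then obtain g where g: "g \<in> I" "\<And>z. z \<noteq> x \<Longrightarrow> z \<noteq> y \<Longrightarrow> f z = g z"
        unfolding forget_def by blast
      have "g a = g x" using g(1) a unfolding partners_def by simp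
      moreover have "f a = g a" using g(2) aX new by metis
      \<comment> \<open>The two functions could differ only at \<open>x\<close> and
        \<open>y\<close>, where both take their common value at \<open>a\<close>.\<close>
      ultimately have "f = g" using g(2) I_xy[OF g(1)] f(1,2) by (intro ext) metis
      then show "f \<in> I" using g(1) by simp
    next
      fix f assume f: "f \<in> I"
      moreover have "f a = f x" using f a unfolding partners_def by simp
      ultimately show "f \<in> invariants (insert_ribbon x y a P' \<union> E)"
        unfolding invariants_ribbon_Un[OF P' aX] key using I_xy I_forget by simp
    qed
  qed
  have ribbon_partner: "a \<in> partners I"
    if "invariants (insert_ribbon x y a P' \<union> E) = I" "a \<in> X'" for a
    using that invariants_ribbon_Un[OF P' that(2)] unfolding partners_def by blast
  have sub: "partners I \<subseteq> X'" unfolding partners_def by auto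
  show ?thesis (is "?L = ?R")
  proof (intro equalityI subsetI)
    fix P assume "P \<in> ?L"
    then have P: "pairing_on X P" "merge_corners {x, y} P = P'" "invariants (P \<union> E) = I" by auto
    from merge_corners_cases(2)[OF new P(1)] show "P \<in> ?R"
      unfolding P(2)
    proof
      assume "P = insert {x, y} P'" then show ?thesis using no_edge P(3) by simp
    next
      assume "\<exists>a\<in>X'. P = insert_ribbon x y a P'"
      then obtain a where "a \<in> X'" "P = insert_ribbon x y a P'" by blast
      then show ?thesis using ribbon_partner[of a] P(3) by auto
    qed
  next
    fix P assume "P \<in> ?R"
    then consider "partners I = {}" "P = insert {x, y} P'"
      | a where "a \<in> partners I" "P = insert_ribbon x y a P'" by (auto split: if_splits)
    then show "P \<in> ?L"
    proof cases
      case 1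
      then show ?thesis
        using edge pairing_insert_edge[OF new P'] merge_insert_edge[OF new P'] by simp
    next
      case 2
      then have "a \<in> X'" using sub by auto
      then show ?thesis unfolding 2(2)
        using ribbon[OF 2(1)] pairing_insert_ribbon[OF new P'] merge_insert_ribbon[OF new P'] by simp
    qed
  qed
qed

lemma inj_insert_ribbon: "inj_on (\<lambda>a. insert_ribbon x y a P') (partners I)"
proof (rule inj_onI)
  fix a b assume "a \<in> partners I" "b \<in> partners I" "insert_ribbon x y a P' = insert_ribbon x y b P'"
  then show "a = b" using mate_insert_ribbon[OF new P'] unfolding partners_def
    by (metis (mono_tags, lifting) mem_Collect_eq)
qed

text \<open>\<open>mate P'\<close> maps partners to partners and reverses \<open>d\<close>, so it
  exchanges the two halves. The free \<open>t\<close> gives the equality and the inequality test the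
  same count.\<close>

lemma card_partners_half:
  assumes d: "alternating P' d"
  shows "card {a \<in> partners I. (d a = s) = t} = card (partners I) div 2"
proof -
  let ?J = "partners I"
  have sub: "?J \<subseteq> X'" unfolding partners_def by auto
  have dm: "d (mate P' a) = (\<not> d a)" if "a \<in> ?J" for a
    using that sub d alternating_iff[OF P'] by blast
  have "bij_betw (mate P') {a \<in> ?J. (d a = s) = t} {a \<in> ?J. (d a = s) \<noteq> t}"
    by (rule bij_betw_byWitness[where f' = "mate P'"])
      (use mate_partners mate_mate[OF P'] sub dm in auto)
  then have "card {a \<in> ?J. (d a = s) = t} = card {a \<in> ?J. (d a = s) \<noteq> t}"
    by (rule bij_betw_same_card)
  moreover have "card ?J = card {a \<in> ?J. (d a = s) = t} + card {a \<in> ?J. (d a = s) \<noteq> t}"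
    by (subst card_Un_disjoint[symmetric]) (use finite_partners in \<open>auto intro: arg_cong[where f = card]\<close>)
  ultimately show ?thesis by simp
qed

end

text \<open>For realised labels, \<open>forget I \<inter> forget J\<close> consists of the
  invariants of the smaller graph, so the condition says that both ends are old vertices of one
  component. Then half of the \<open>b\<close> are admissible for each \<open>a\<close>. Otherwise
  all choices are, and \<open>max 1\<close> accounts for the single insertion at a new
  vertex.\<close>

definition extension_count :: "('a \<Rightarrow> bool) set \<Rightarrow> ('a \<Rightarrow> bool) set \<Rightarrow> nat" where
  "extension_count I J =
    (if partners I \<noteq> {} \<and> partners J \<noteq> {} \<and>
        (\<forall>f\<in>forget I \<inter> forget J. \<forall>a\<in>partners I. \<forall>b\<in>partners J. f a = f b)
     then card (partners I) * (card (partners J) div 2)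
     else max 1 (card (partners I)) * max 1 (card (partners J)))"

text \<open>Common to both kinds of maps: \<open>ok\<close> is the property asked of the extension,
  and \<open>t\<close> tells whether connected ends require equal or opposite directions. The count
  fixes \<open>a\<close> and lets \<open>b\<close> vary, so \<open>d\<close> has to alternate on
  \<open>Q'\<close>.\<close>

lemma card_extensions:
  assumes P0: "pairing_on X P0" and I: "I = invariants (P0 \<union> E)"
    and P': "pairing_on X' P'" and keyP: "invariants (P' \<union> E') = forget I"
    and Q0: "pairing_on X Q0" and J: "J = invariants (Q0 \<union> E)"
    and Q': "pairing_on X' Q'" and keyQ: "invariants (Q' \<union> E') = forget J"
    and d: "alternating Q' d"
    and edge1: "\<And>Q. pairing_on X Q \<Longrightarrow> merge_corners {x, y} Q = Q' \<Longrightarrow> ok (insert {x, y} P') Q"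
    and edge2: "\<And>P. pairing_on X P \<Longrightarrow> merge_corners {x, y} P = P' \<Longrightarrow> ok P (insert {x, y} Q')"
    and disconnected: "\<And>a b f. a \<in> X' \<Longrightarrow> b \<in> X' \<Longrightarrow> f \<in> invariants (P' \<union> E') \<Longrightarrow>
      f \<in> invariants (Q' \<union> E') \<Longrightarrow> f a \<noteq> f b \<Longrightarrow> ok (insert_ribbon x y a P') (insert_ribbon x y b Q')"
    and connected: "\<And>a b. a \<in> X' \<Longrightarrow> b \<in> X' \<Longrightarrow>
      (\<And>f. f \<in> invariants (P' \<union> E') \<Longrightarrow> f \<in> invariants (Q' \<union> E') \<Longrightarrow> f a = f b) \<Longrightarrow>
      ok (insert_ribbon x y a P') (insert_ribbon x y b Q') \<longleftrightarrow> (d b = d a) = t"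
  shows "card {(P, Q). (pairing_on X P \<and> merge_corners {x, y} P = P' \<and> invariants (P \<union> E) = I) \<and>
      (pairing_on X Q \<and> merge_corners {x, y} Q = Q' \<and> invariants (Q \<union> E) = J) \<and> ok P Q} =
    extension_count I J"
proof -
  define S where "S = {P. pairing_on X P \<and> merge_corners {x, y} P = P' \<and> invariants (P \<union> E) = I}"
  define T where "T = {Q. pairing_on X Q \<and> merge_corners {x, y} Q = Q' \<and> invariants (Q \<union> E) = J}"
  note S = extensions_eq[OF P0 I P' keyP, folded S_def]
  note T = extensions_eq[OF Q0 J Q' keyQ, folded T_def]
  note injS = inj_insert_ribbon[OF P0 I P' keyP]
  note injT = inj_insert_ribbon[OF Q0 J Q' keyQ]
  let ?f = "\<lambda>a. insert_ribbon x y a P'" and ?g = "\<lambda>a. insert_ribbon x y a Q'"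
  have sub: "partners I \<subseteq> X'" "partners J \<subseteq> X'" unfolding partners_def by auto
  have cS: "card S = max 1 (card (partners I))"
    unfolding S using card_image[OF injS] finite_partners[of I] by (auto simp: Suc_le_eq card_gt_0_iff max_def)
  have cT: "card T = max 1 (card (partners J))"
    unfolding T using card_image[OF injT] finite_partners[of J] by (auto simp: Suc_le_eq card_gt_0_iff max_def)
  have eq: "{(P, Q). (pairing_on X P \<and> merge_corners {x, y} P = P' \<and> invariants (P \<union> E) = I) \<and>
      (pairing_on X Q \<and> merge_corners {x, y} Q = Q' \<and> invariants (Q \<union> E) = J) \<and> ok P Q} =
    {(P, Q). P \<in> S \<and> Q \<in> T \<and> ok P Q}" unfolding S_def T_def by auto
  show ?thesis
  proof (cases "partners I \<noteq> {} \<and> partners J \<noteq> {} \<and>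
        (\<forall>f\<in>forget I \<inter> forget J. \<forall>a\<in>partners I. \<forall>b\<in>partners J. f a = f b)")
    case True
    have ok: "ok (?f a) (?g b) \<longleftrightarrow> (d b = d a) = t" if "a \<in> partners I" "b \<in> partners J" for a b
    proof (rule connected)
      show "a \<in> X'" "b \<in> X'" using that sub by auto
      fix f assume "f \<in> invariants (P' \<union> E')" "f \<in> invariants (Q' \<union> E')"
      then show "f a = f b" using True that unfolding keyP keyQ by auto
    qed
    have "{(P, Q). P \<in> S \<and> Q \<in> T \<and> ok P Q} =
        map_prod ?f ?g ` (SIGMA a:partners I. {b \<in> partners J. (d b = d a) = t})" (is "?A = ?B")
    proof (intro equalityI subsetI)
      fix p assume "p \<in> ?A"
      then obtain P Q where p: "p = (P, Q)" "P \<in> S" "Q \<in> T" "ok P Q" by blast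
      then obtain a b where "a \<in> partners I" "b \<in> partners J" "P = ?f a" "Q = ?g b"
        using S T True by auto
      then show "p \<in> ?B" using p ok by auto
    next
      fix p assume "p \<in> ?B"
      then show "p \<in> ?A" using S T True ok by auto
    qed
    moreover have "inj_on (map_prod ?f ?g) (partners I \<times> partners J)"
      by (rule map_prod_inj_on[OF injS injT])
    then have "inj_on (map_prod ?f ?g) (SIGMA a:partners I. {b \<in> partners J. (d b = d a) = t})"
      by (rule inj_on_subset) auto
    ultimately have "card {(P, Q). P \<in> S \<and> Q \<in> T \<and> ok P Q} =
        card (SIGMA a:partners I. {b \<in> partners J. (d b = d a) = t})"
      by (simp add: card_image)
    also have "\<dots> = (\<Sum>a\<in>partners I. card {b \<in> partners J. (d b = d a) = t})"
      by (rule card_SigmaI) (use finite_partners in auto)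
    also have "\<dots> = card (partners I) * (card (partners J) div 2)"
      using card_partners_half[OF Q0 J Q' keyQ d] by simp
    finally show ?thesis unfolding eq extension_count_def using True by simp
  next
    case False
    have "ok P Q" if PQ: "P \<in> S" "Q \<in> T" for P Q
    proof -
      consider "partners I = {}" | "partners J = {}"
        | "partners I \<noteq> {}" "partners J \<noteq> {}" by blast
      then show ?thesis
      proof cases
        case 1
        then have "P = insert {x, y} P'" using PQ(1) S by simp
        then show ?thesis using edge1 PQ(2) unfolding T_def by simp
      next
        case 2
        then have "Q = insert {x, y} Q'" using PQ(2) T by simp
        then show ?thesis using edge2 PQ(1) unfolding S_def by simp
      next
        case 3
        obtain a b where ab: "a \<in> partners I" "b \<in> partners J" "P = ?f a" "Q = ?g b"
          using PQ S T 3 by auto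
        obtain f a' b' where f: "f \<in> forget I" "f \<in> forget J" "a' \<in> partners I" "b' \<in> partners J" "f a' \<noteq> f b'"
          using False 3 by blast
        \<comment> \<open>The separating \<open>f\<close> is known only for some partners
          \<open>a'\<close> and \<open>b'\<close>; constancy on partners moves the separation to the
          given \<open>a\<close> and \<open>b\<close>.\<close>
        have "f a = f a'" "f b = f b'"
          using partners_const[OF P0 I P' keyP ab(1) f(3,1)] partners_const[OF Q0 J Q' keyQ ab(2) f(4,2)] .
        then show ?thesis unfolding ab(3,4) using disconnected[of a b f] f ab sub keyP keyQ by auto
      qed
    qed
    then have "{(P, Q). P \<in> S \<and> Q \<in> T \<and> ok P Q} = S \<times> T" by auto
    then show ?thesis unfolding eq extension_count_def using False cS cT by (simp only: card_cartesian_product if_False)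
  qed
qed

end

subsection \<open>Faces and orientations of the extensions\<close>

context edge_insertion
begin

context
  fixes P Q :: "'a set set"
  assumes P: "pairing_on X' P" and Q: "pairing_on X' Q"
begin

text \<open>The corner \<open>{x, y}\<close> of the new vertex forces \<open>f x = f y\<close>,
  which makes the ribbon invisible at its other end. Exchanging \<open>P\<close> and
  \<open>Q\<close> covers the other colour.\<close>

lemma invariants_insert_edge_subset:
  assumes top: "invariants P \<inter> invariants Q \<subseteq> invariants E'"
    and R: "pairing_on X R" "merge_corners {x, y} R = Q"
  shows "invariants (insert {x, y} P) \<inter> invariants R \<subseteq> invariants E"
proof
  fix f assume "f \<in> invariants (insert {x, y} P) \<inter> invariants R"
  then have f: "f x = f y" "f \<in> invariants P" "f \<in> invariants R"
    by (auto simp: invariants_insert_pair)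
  from merge_corners_cases(2)[OF new R(1)] have "f \<in> invariants Q"
    unfolding R(2)
  proof
    assume "R = insert {x, y} Q"
    then show ?thesis using f by (simp add: invariants_insert_pair)
  next
    assume "\<exists>a\<in>X'. R = insert_ribbon x y a Q"
    then show ?thesis using f invariants_insert_ribbon_eq_iff[OF new Q _ f(1)] by auto
  qed
  then show "f \<in> invariants E" using f top by (auto simp: invariants_insert_pair)
qed

lemma ex_alternating_insert_edge:
  assumes d: "alternating P d" "alternating Q d" "alternating E' d"
    and R: "pairing_on X R" "merge_corners {x, y} R = Q"
  shows "\<exists>d. alternating (insert {x, y} P) d \<and> alternating R d \<and> alternating E d"
  using merge_corners_cases(2)[OF new R(1)] unfolding R(2)
proof
  assume "R = insert {x, y} Q"
  then show ?thesis using d new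
    by (intro exI[of _ "d(x := True, y := False)"])
      (simp add: alternating_insert_pair alternating_upd P Q E')
next
  assume "\<exists>a\<in>X'. R = insert_ribbon x y a Q"
  then obtain a where a: "a \<in> X'" "R = insert_ribbon x y a Q" by blast
  show ?thesis using d new a
    by (intro exI[of _ "d(x := \<not> d a, y := d a)"])
      (auto simp: alternating_insert_pair alternating_upd P Q E'
        alternating_insert_ribbon_neq_iff[OF new Q a(1)])
qed

text \<open>\<open>x\<close> has to oppose both sides that it faces; as \<open>a\<close> and
  \<open>b\<close> agree, this determines \<open>x\<close>, and \<open>y\<close> gets the other
  value.\<close>

lemma ribbon_ribbon_orientable:
  assumes ab: "a \<in> X'" "b \<in> X'"
    and d: "alternating P d" "alternating Q d" "alternating E' d" "d b = d a"
  shows "\<exists>d. alternating (insert_ribbon x y a P) d \<and> alternating (insert_ribbon x y b Q) d \<and> alternating E d"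
  using d new ab
  by (intro exI[of _ "d(x := \<not> d a, y := d a)"])
    (auto simp: alternating_insert_pair alternating_upd P Q E'
      alternating_insert_ribbon_neq_iff[OF new P ab(1)]
      alternating_insert_ribbon_neq_iff[OF new Q ab(2)])

text \<open>If \<open>a\<close> and \<open>b\<close> disagree, reversing \<open>d\<close> where
  \<open>h\<close> holds makes them agree, because \<open>h\<close> holds at just one of
  them.\<close>

lemma ribbon_ribbon_orientable_disconnected:
  assumes ab: "a \<in> X'" "b \<in> X'"
    and d: "alternating P d" "alternating Q d" "alternating E' d"
    and h: "h \<in> invariants P" "h \<in> invariants Q" "h \<in> invariants E'" "h a \<noteq> h b"
  shows "\<exists>d. alternating (insert_ribbon x y a P) d \<and> alternating (insert_ribbon x y b Q) d \<and> alternating E d"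
proof (cases "d b = d a")
  case True
  then show ?thesis using ribbon_ribbon_orientable[OF ab d] by blast
next
  case False
  let ?d = "\<lambda>z. d z \<noteq> h z"
  have "alternating P ?d" "alternating Q ?d" "alternating E' ?d"
    using d h alternating_flip by blast+
  moreover have "?d b = ?d a" using False h(4) by auto
  ultimately show ?thesis using ribbon_ribbon_orientable[OF ab] by blast
qed

text \<open>An orientation of the extension restricts to the smaller map with equal values at
  \<open>a\<close> and \<open>b\<close>. Its agreement with \<open>d\<close> is an invariant, hence
  the same at \<open>a\<close> and \<open>b\<close>, so \<open>d\<close> has equal values there
  too.\<close>

lemma ribbon_ribbon_orientable_connected:
  assumes ab: "a \<in> X'" "b \<in> X'"
    and d: "alternating P d" "alternating Q d" "alternating E' d"
    and conn: "\<And>h. h \<in> invariants P \<Longrightarrow> h \<in> invariants Q \<Longrightarrow> h \<in> invariants E' \<Longrightarrow> h a = h b"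
  shows "(\<exists>d. alternating (insert_ribbon x y a P) d \<and> alternating (insert_ribbon x y b Q) d \<and>
    alternating E d) \<longleftrightarrow> d b = d a"
proof
  assume "\<exists>d. alternating (insert_ribbon x y a P) d \<and> alternating (insert_ribbon x y b Q) d \<and> alternating E d"
  then obtain d' where d': "alternating (insert_ribbon x y a P) d'"
    "alternating (insert_ribbon x y b Q) d'" "alternating E d'" by blast
  have xy: "d' x \<noteq> d' y" "alternating E' d'" using d'(3) alternating_insert_pair[OF new(1)] by metis+
  have "d' a \<noteq> d' x" "alternating P d'" "d' b \<noteq> d' x" "alternating Q d'"
    using d' alternating_insert_ribbon_neq_iff[of x y X' P a d']
      alternating_insert_ribbon_neq_iff[of x y X' Q b d'] new P Q ab xy(1) by auto
  then have "(d a = d' a) = (d b = d' b)" "d' a = d' b"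
    using conn[of "\<lambda>z. d z = d' z"] invariants_alternating_eq d xy(2) P Q E' by blast+
  then show "d b = d a" by blast
qed (rule ribbon_ribbon_orientable[OF ab d])

text \<open>The two corners to be split lie on different faces. The walk around the face of
  \<open>a\<close>, from \<open>a\<close> to \<open>mate P a\<close>, never meets the corner at
  \<open>b\<close>, so \<open>f x = f y\<close>: the ribbon joins both faces into one.\<close>

lemma ribbon_ribbon_top_degree_disconnected:
  assumes ab: "a \<in> X'" "b \<in> X'"
    and top: "invariants P \<inter> invariants Q \<subseteq> invariants E'"
    and h: "h \<in> invariants P" "h \<in> invariants Q" "h a \<noteq> h b"
  shows "invariants (insert_ribbon x y a P) \<inter> invariants (insert_ribbon x y b Q) \<subseteq> invariants E"
proof
  fix f assume f: "f \<in> invariants (insert_ribbon x y a P) \<inter> invariants (insert_ribbon x y b Q)"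
  then have fP: "f a = f x" "f (mate P a) = f y"
      "\<And>u. u \<in> X' \<Longrightarrow> u \<noteq> a \<Longrightarrow> u \<noteq> mate P a \<Longrightarrow> f (mate P u) = f u"
    and fQ: "f b = f x" "\<And>u. u \<in> X' \<Longrightarrow> u \<noteq> b \<Longrightarrow> u \<noteq> mate Q b \<Longrightarrow> f (mate Q u) = f u"
    unfolding Int_iff invariants_insert_ribbon_iff[OF new P ab(1)]
      invariants_insert_ribbon_iff[OF new Q ab(2)] by blast+
  note mem = walk_mem[OF finite P Q ab(1)]
  have hb: "h (mate Q b) = h b" using h(2) invariants_iff[OF Q] ab by blast
  obtain d where d: "alternating P d" "alternating Q d" using ex_alternating[OF finite P Q] by blast
  \<comment> \<open>The least positive return time: the corner at \<open>a\<close> is crossed only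
    by the last step.\<close>
  define k where "k = (LEAST k. k > 0 \<and> ((\<lambda>z. mate P (mate Q z)) ^^ k) a = a)"
  define w where "w i = ((\<lambda>z. mate P (mate Q z)) ^^ i) a" for i
  have k: "k > 0" "w k = a"
    using LeastI_ex[OF walk_periodic[OF finite P Q ab(1)]] unfolding k_def w_def by auto
  have least: "\<not> (i > 0 \<and> w i = a)" if "i < k" for i
    using not_less_Least[of i "\<lambda>k. k > 0 \<and> w k = a"] that unfolding k_def w_def by blast
  obtain m where m: "k = Suc m" using k(1) by (cases k) auto
  have wm: "w i \<in> X'" "mate Q (w i) \<in> X'" for i
    using mem mate_mem[OF Q] unfolding w_def by auto
  have Qstep: "f (mate Q (w i)) = f (w i)" for i
  proof (rule fQ(2))
    have "h (w i) = h a" using walk_invariant(1)[OF finite P Q ab(1) h(1,2)] unfolding w_def .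
    then show "w i \<noteq> b" "w i \<noteq> mate Q b" using h(3) hb by auto
  qed (rule wm)
  have Pstep: "f (mate P (mate Q (w i))) = f (mate Q (w i))" if "i < m" for i
  proof (rule fP(3)[OF wm(2)])
    show "mate Q (w i) \<noteq> a" using walk_alternating(2)[OF finite P Q ab(1) d, of i] unfolding w_def by auto
    show "mate Q (w i) \<noteq> mate P a"
    proof
      assume "mate Q (w i) = mate P a"
      then have "w (Suc i) = a" using mate_mate[OF P ab(1)] unfolding w_def by simp
      then show False using least[of "Suc i"] that m by simp
    qed
  qed
  have "f (w m) = f a"
    unfolding w_def by (rule walk_const[OF finite P Q]) (use Qstep Pstep in \<open>auto simp: w_def\<close>)
  moreover have "mate Q (w m) = mate P a"
    using k(2) mate_mate[OF P wm(2), of m] unfolding m w_def by simp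
  ultimately have "f (mate P a) = f a" using Qstep[of m] by simp
  then have xy: "f x = f y" using fP by simp
  have "f \<in> invariants P" "f \<in> invariants Q"
    using f invariants_insert_ribbon_eq_iff[OF new P ab(1) xy]
      invariants_insert_ribbon_eq_iff[OF new Q ab(2) xy] by auto
  then show "f \<in> invariants E" using top xy by (auto simp: invariants_insert_pair)
qed

text \<open>The walk along the face from \<open>a\<close> stops at the side of the second corner that has the same
  direction as \<open>a\<close>. If this is \<open>b\<close>, the ribbon splits the face; if it is the partner of \<open>b\<close>, the
  walk connects the two sides \<open>x\<close> and \<open>y\<close> of the ribbon.\<close>

lemma ribbon_ribbon_top_degree_connected:
  assumes ab: "a \<in> X'" "b \<in> X'"
    and top: "invariants P \<inter> invariants Q \<subseteq> invariants E'"
    and d: "alternating P d" "alternating Q d"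
    and conn: "\<And>h. h \<in> invariants P \<Longrightarrow> h \<in> invariants Q \<Longrightarrow> h a = h b"
  shows "invariants (insert_ribbon x y a P) \<inter> invariants (insert_ribbon x y b Q) \<subseteq> invariants E \<longleftrightarrow>
    d b \<noteq> d a"
proof -
  define w where "w i = ((\<lambda>z. mate P (mate Q z)) ^^ i) a" for i
  note ribbon_iffs = invariants_insert_ribbon_iff[OF new P ab(1)] invariants_insert_ribbon_iff[OF new Q ab(2)]
  have wm: "w i \<in> X'" "mate Q (w i) \<in> X'" for i
    using walk_mem[OF finite P Q ab(1)] mate_mem[OF Q] unfolding w_def by auto
  have dw: "d (w i) = d a" "d (mate Q (w i)) = (\<not> d a)" for i
    using walk_alternating[OF finite P Q ab(1) d] unfolding w_def by auto
  have dP: "d (mate P a) = (\<not> d a)" and dQ: "d (mate Q b) = (\<not> d b)"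
    using d[unfolded alternating_iff[OF P] alternating_iff[OF Q]] ab by auto
  define c where "c = (if d b = d a then b else mate Q b)"
  have c: "c \<in> X'" "d c = d a" using ab mate_mem[OF Q] dQ unfolding c_def by auto
  have connc: "h a = h c" if "h \<in> invariants P" "h \<in> invariants Q" for h
    using conn[OF that] that(2) invariants_iff[OF Q] ab unfolding c_def by auto
  obtain k where k: "w k = c" "\<And>i. i < k \<Longrightarrow> w i \<noteq> c"
    using walk_reaches[OF finite P Q ab(1) c(1) d c(2) connc] unfolding w_def by blast
  \<comment> \<open>Meeting \<open>mate P a\<close> would lead back to the start; cutting out that
    round would reach \<open>c\<close> earlier, against the minimality of \<open>k\<close>.\<close>
  have no_return: "mate Q (w i) \<noteq> mate P a" if "i < k" for i
  proof
    assume "mate Q (w i) = mate P a"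
    then have ret: "w (Suc i) = a" using mate_mate[OF P ab(1)] unfolding w_def by simp
    have "w k = w (k - Suc i)"
    proof -
      have "w k = ((\<lambda>z. mate P (mate Q z)) ^^ (k - Suc i)) (w (Suc i))"
        unfolding w_def using that by (metis Suc_leI comp_apply funpow_add le_add_diff_inverse2)
      then show ?thesis unfolding ret by (simp add: w_def)
    qed
    then show False using k that by (metis Suc_leI diff_less zero_less_Suc le_trans less_le_trans)
  qed
  show ?thesis
  proof
    assume sub: "invariants (insert_ribbon x y a P) \<inter> invariants (insert_ribbon x y b Q) \<subseteq> invariants E"
    show "d b \<noteq> d a"
    proof
      assume dba: "d b = d a"
      then have cb: "c = b" unfolding c_def by simp
      \<comment> \<open>The arc of the face from \<open>a\<close> to \<open>b\<close>. Its ends face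
        \<open>x\<close>, while it avoids their partners, which face \<open>y\<close>; together with
        \<open>x\<close> it is closed under all corners of the extension.\<close>
      define f where "f z \<longleftrightarrow> (\<exists>i\<le>k. z = w i) \<or> (\<exists>i<k. z = mate Q (w i))" for z
      let ?f = "f(x := True, y := False)"
      have fa: "f a" unfolding f_def w_def by (auto intro!: exI[of _ 0])
      have fb: "f b" unfolding f_def using k(1) cb by blast
      have fPa: "\<not> f (mate P a)"
        unfolding f_def using dw dP no_return by metis
      have fQb: "\<not> f (mate Q b)"
        unfolding f_def using dw dQ dba k cb mate_mate[OF Q] wm ab(2) by metis
      have P_closed: "f (mate P u)" if ua: "u \<noteq> a" and fu: "f u" for u
        using fu unfolding f_def
      proof (elim disjE exE conjE)
        fix i assume i: "i \<le> k" "u = w i"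
        then obtain j where "i = Suc j" using ua by (cases i) (auto simp: w_def)
        then have "mate P u = mate Q (w j)" "j < k"
          using i mate_mate[OF P wm(2)] by (auto simp: w_def)
        then show "(\<exists>i\<le>k. mate P u = w i) \<or> (\<exists>i<k. mate P u = mate Q (w i))" by blast
      next
        fix i assume i: "i < k" "u = mate Q (w i)"
        then have "mate P u = w (Suc i)" "Suc i \<le> k" by (auto simp: w_def)
        then show "(\<exists>i\<le>k. mate P u = w i) \<or> (\<exists>i<k. mate P u = mate Q (w i))" by blast
      qed
      have Q_closed: "f (mate Q u)" if "u \<noteq> b" "f u" for u
        using that(2) unfolding f_def
      proof (elim disjE exE conjE)
        fix i assume i: "i \<le> k" "u = w i"
        then have "i < k" using that(1) k(1) cb by (cases "i = k") auto
        then show "(\<exists>i\<le>k. mate Q u = w i) \<or> (\<exists>i<k. mate Q u = mate Q (w i))" using i by blast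
      next
        fix i assume i: "i < k" "u = mate Q (w i)"
        then have "mate Q u = w i" using mate_mate[OF Q wm(1)] by simp
        then show "(\<exists>i\<le>k. mate Q u = w i) \<or> (\<exists>i<k. mate Q u = mate Q (w i))" using i(1) less_imp_le by blast
      qed
      have old: "?f z = f z" if "z \<in> X'" for z using that new by auto
      have "f (mate P u) = f u" if "u \<in> X'" "u \<noteq> a" "u \<noteq> mate P a" for u
        using P_closed[of u] P_closed[of "mate P u"] mate_mate[OF P] that by metis
      then have "?f \<in> invariants (insert_ribbon x y a P)"
        unfolding ribbon_iffs using old ab mate_mem[OF P] fa fPa new by simp
      moreover have "f (mate Q u) = f u" if "u \<in> X'" "u \<noteq> b" "u \<noteq> mate Q b" for u
        using Q_closed[of u] Q_closed[of "mate Q u"] mate_mate[OF Q] that by metis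
      then have "?f \<in> invariants (insert_ribbon x y b Q)"
        unfolding ribbon_iffs using old ab mate_mem[OF Q] fb fQb new by simp
      ultimately have "?f \<in> invariants E" using sub by blast
      then have "?f x = ?f y" by (simp only: invariants_insert_pair)
      then show False using new by simp
    qed
  next
    assume dba: "d b \<noteq> d a"
    then have cb: "c = mate Q b" unfolding c_def by simp
    show "invariants (insert_ribbon x y a P) \<inter> invariants (insert_ribbon x y b Q) \<subseteq> invariants E"
    proof
      fix f assume f: "f \<in> invariants (insert_ribbon x y a P) \<inter> invariants (insert_ribbon x y b Q)"
      then have fP: "f a = f x" "\<And>u. u \<in> X' \<Longrightarrow> u \<noteq> a \<Longrightarrow> u \<noteq> mate P a \<Longrightarrow> f (mate P u) = f u"
        and fQ: "f (mate Q b) = f y"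
          "\<And>u. u \<in> X' \<Longrightarrow> u \<noteq> b \<Longrightarrow> u \<noteq> mate Q b \<Longrightarrow> f (mate Q u) = f u"
        unfolding Int_iff ribbon_iffs by blast+
      \<comment> \<open>The direction \<open>d\<close>, the minimality of \<open>k\<close> and
        \<open>no_return\<close> keep the walk from crossing either opened corner before it arrives
        at \<open>mate Q b\<close>.\<close>
      have "f (w k) = f a" unfolding w_def
      proof (rule walk_const[OF finite P Q], unfold w_def[symmetric])
        fix i assume i: "i < k"
        show "f (mate Q (w i)) = f (w i)"
          by (rule fQ(2)[OF wm(1)]) (use dw(1)[of i] dba k(2)[OF i] cb in auto)
        show "f (mate P (mate Q (w i))) = f (mate Q (w i))"
          by (rule fP(2)[OF wm(2)]) (use dw(2)[of i] no_return[OF i] in auto)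
      qed
      then have xy: "f x = f y" using k(1) cb fP(1) fQ(1) by simp
      have "f \<in> invariants P" "f \<in> invariants Q"
        using f invariants_insert_ribbon_eq_iff[OF new P ab(1) xy]
          invariants_insert_ribbon_eq_iff[OF new Q ab(2) xy] by auto
      then show "f \<in> invariants E" using top xy by (auto simp: invariants_insert_pair)
    qed
  qed
qed

end

end

subsection \<open>Counting maps along a history\<close>

primrec along :: "('a bimap \<Rightarrow> bool) \<Rightarrow> 'a set list \<Rightarrow> 'a bimap \<Rightarrow> bool" where
  "along t [] M \<longleftrightarrow> t M"
| "along t (e # es) M \<longleftrightarrow> t M \<and> along t es (remove_edge e M)"

lemma along_iff: "along t es M \<longleftrightarrow> (\<forall>i\<le>length es. t (fold remove_edge (take i es) M))"
proof (induction es arbitrary: M)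
  case (Cons e es)
  have "(\<forall>i\<le>length (e # es). t (fold remove_edge (take i (e # es)) M)) \<longleftrightarrow>
      t M \<and> (\<forall>i\<le>length es. t (fold remove_edge (take i es) (remove_edge e M)))"
    (is "?L \<longleftrightarrow> ?R")
  proof
    assume L: ?L
    have "t (fold remove_edge (take i es) (remove_edge e M))" if "i \<le> length es" for i
      using L[rule_format, of "Suc i"] that by simp
    then show ?R using L[rule_format, of 0] by simp
  next
    assume R: ?R
    show ?L
    proof (intro allI impI)
      fix i assume "i \<le> length (e # es)"
      then show "t (fold remove_edge (take i (e # es)) M)" using R by (cases i) auto
    qed
  qed
  then show ?case using Cons.IH by simp
qed simp

lemma along_imp: "along t es M \<Longrightarrow> t M"
  by (cases es) auto

text \<open>The edges, their order and both vertex partitions are fixed; what varies is the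
  arrangement of the sides around the vertices.\<close>

definition maps_along :: "('a bimap \<Rightarrow> bool) \<Rightarrow> 'a set list \<Rightarrow> ('a \<Rightarrow> bool) set \<Rightarrow> ('a \<Rightarrow> bool) set
    \<Rightarrow> ('a set set \<times> 'a set set) set" where
  "maps_along t es I J = {(P, Q). pairing_on (\<Union>(set es)) P \<and> pairing_on (\<Union>(set es)) Q \<and>
     invariants (P \<union> set es) = I \<and> invariants (Q \<union> set es) = J \<and> along t es (Bimap P Q (set es))}"

lemma mem_maps_along:
  assumes "pairing_on X (set es)"
  shows "(P, Q) \<in> maps_along t es I J \<longleftrightarrow> pairing_on X P \<and> pairing_on X Q \<and>
    invariants (P \<union> set es) = I \<and> invariants (Q \<union> set es) = J \<and> along t es (Bimap P Q (set es))"
  using pairing_Union[OF assms] unfolding maps_along_def by simp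

lemma finite_maps_along:
  assumes "pairing_on X (set es)" shows "finite (maps_along t es I J)"
proof -
  have "finite p" if "p \<in> set es" for p
    using assms that unfolding pairing_on_def by (auto intro: card_ge_0_finite)
  then have "finite (\<Union>(set es))" by blast
  then have "finite (Pow (Pow X) \<times> Pow (Pow X))" unfolding pairing_Union[OF assms] by simp
  moreover have "maps_along t es I J \<subseteq> Pow (Pow X) \<times> Pow (Pow X)"
  proof
    fix p assume p: "p \<in> maps_along t es I J"
    obtain P Q where p_eq: "p = (P, Q)" by (cases p)
    with p have "pairing_on X P" "pairing_on X Q" by (simp_all add: mem_maps_along[OF assms])
    then have "\<Union>P = X" "\<Union>Q = X" using pairing_Union by blast+
    then show "p \<in> Pow (Pow X) \<times> Pow (Pow X)" unfolding p_eq by auto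
  qed
  ultimately show ?thesis by (rule finite_subset[rotated])
qed

context edge_insertion
begin

lemma alternating_merge_corners:
  assumes P: "pairing_on X P" and d: "alternating P d" "d x \<noteq> d y"
  shows "alternating (merge_corners {x, y} P) d"
proof -
  note c = merge_corners_cases[OF new P]
  from c(2) show ?thesis
  proof
    assume "P = insert {x, y} (merge_corners {x, y} P)"
    then show ?thesis using d alternating_insert_pair[OF new(1)] by metis
  next
    assume "\<exists>a\<in>X'. P = insert_ribbon x y a (merge_corners {x, y} P)"
    then show ?thesis using d alternating_insert_ribbon_neq_iff[OF new c(1)] by metis
  qed
qed

text \<open>An orientation has opposite values on the two sides of the deleted ribbon, so it
  restricts to what remains.\<close>

lemma orientable_remove_edge:
  assumes P: "pairing_on X P" and Q: "pairing_on X Q" and o: "orientable (Bimap P Q E)"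
  shows "orientable (Bimap (merge_corners {x, y} P) (merge_corners {x, y} Q) E')"
proof -
  obtain d where "alternating P d" "alternating Q d" "alternating E d"
    using o unfolding orientable_iff by blast
  then show ?thesis unfolding orientable_iff
    using alternating_merge_corners[OF P] alternating_merge_corners[OF Q]
      alternating_insert_pair[OF new(1)] by metis
qed

definition extensions :: "('a bimap \<Rightarrow> bool) \<Rightarrow> ('a \<Rightarrow> bool) set \<Rightarrow> ('a \<Rightarrow> bool) set \<Rightarrow>
    'a set set \<times> 'a set set \<Rightarrow> ('a set set \<times> 'a set set) set" where
  "extensions t I J M' = {(P, Q).
      (pairing_on X P \<and> merge_corners {x, y} P = fst M' \<and> invariants (P \<union> E) = I) \<and>
      (pairing_on X Q \<and> merge_corners {x, y} Q = snd M' \<and> invariants (Q \<union> E) = J) \<and>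
      t (Bimap P Q E)}"

lemma nonoriented_map_extension:
  assumes "pairing_on X P" "pairing_on X Q"
  shows "nonoriented_map X (Bimap P Q E)"
  using assms pairing_insert_edge[OF new E'] unfolding nonoriented_map_def by simp

context
  fixes P0 Q0 I J P' Q'
  assumes P0: "pairing_on X P0" and I: "I = invariants (P0 \<union> E)"
    and Q0: "pairing_on X Q0" and J: "J = invariants (Q0 \<union> E)"
    and P': "pairing_on X' P'" and keyP: "invariants (P' \<union> E') = forget I"
    and Q': "pairing_on X' Q'" and keyQ: "invariants (Q' \<union> E') = forget J"
begin

lemma card_extensions_orientable:
  assumes "orientable (Bimap P' Q' E')"
  shows "card (extensions orientable I J (P', Q')) = extension_count I J"
proof -
  obtain d where d: "alternating P' d" "alternating Q' d" "alternating E' d"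
    using assms unfolding orientable_iff by blast
  show ?thesis unfolding extensions_def fst_conv snd_conv
  proof (rule card_extensions[OF P0 I P' keyP Q0 J Q' keyQ d(2), where t = True])
    fix Q assume "pairing_on X Q" "merge_corners {x, y} Q = Q'"
    then show "orientable (Bimap (insert {x, y} P') Q E)"
      unfolding orientable_iff by (rule ex_alternating_insert_edge[OF P' Q' d])
  next
    fix P assume "pairing_on X P" "merge_corners {x, y} P = P'"
    then show "orientable (Bimap P (insert {x, y} Q') E)"
      unfolding orientable_iff using ex_alternating_insert_edge[OF Q' P' d(2,1,3)] by blast
  next
    fix a b f assume "a \<in> X'" "b \<in> X'" "f \<in> invariants (P' \<union> E')" "f \<in> invariants (Q' \<union> E')" "f a \<noteq> f b"
    then show "orientable (Bimap (insert_ribbon x y a P') (insert_ribbon x y b Q') E)"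
      unfolding orientable_iff invariants_Un
      by (intro ribbon_ribbon_orientable_disconnected[OF P' Q' _ _ d]) auto
  next
    fix a b assume ab: "a \<in> X'" "b \<in> X'"
      and conn: "\<And>f. f \<in> invariants (P' \<union> E') \<Longrightarrow> f \<in> invariants (Q' \<union> E') \<Longrightarrow> f a = f b"
    have "orientable (Bimap (insert_ribbon x y a P') (insert_ribbon x y b Q') E) \<longleftrightarrow> d b = d a"
      unfolding orientable_iff
      by (rule ribbon_ribbon_orientable_connected[OF P' Q' ab d], rule conn) (auto simp: invariants_Un)
    then show "orientable (Bimap (insert_ribbon x y a P') (insert_ribbon x y b Q') E) \<longleftrightarrow> (d b = d a) = True"
      by simp
  qed
qed

lemma card_extensions_top_degree:
  assumes "top_degree (Bimap P' Q' E')"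
  shows "card (extensions top_degree I J (P', Q')) = extension_count I J"
proof -
  have "nonoriented_map X' (Bimap P' Q' E')" using P' Q' E' unfolding nonoriented_map_def by simp
  then have top: "invariants P' \<inter> invariants Q' \<subseteq> invariants E'" using assms top_degree_iff by blast
  \<comment> \<open>Here \<open>d\<close> orients only the polygons, so it exists even if the glued
    surface is not orientable.\<close>
  obtain d where d: "alternating P' d" "alternating Q' d" using ex_alternating[OF finite P' Q'] by blast
  note top_iff = top_degree_iff[OF nonoriented_map_extension]
  note edge = pairing_insert_edge[OF new P'] pairing_insert_edge[OF new Q']
  note ribbon = pairing_insert_ribbon[OF new P'] pairing_insert_ribbon[OF new Q']
  show ?thesis unfolding extensions_def fst_conv snd_conv
  proof (rule card_extensions[OF P0 I P' keyP Q0 J Q' keyQ d(2), where t = False])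
    fix Q assume "pairing_on X Q" "merge_corners {x, y} Q = Q'"
    then show "top_degree (Bimap (insert {x, y} P') Q E)"
      using top_iff[OF edge(1)] invariants_insert_edge_subset[OF P' Q' top] by blast
  next
    fix P assume "pairing_on X P" "merge_corners {x, y} P = P'"
    then show "top_degree (Bimap P (insert {x, y} Q') E)"
      using top_iff[OF _ edge(2)] invariants_insert_edge_subset[OF Q' P'] top by (metis Int_commute)
  next
    fix a b f assume ab: "a \<in> X'" "b \<in> X'" and f: "f \<in> invariants (P' \<union> E')" "f \<in> invariants (Q' \<union> E')" "f a \<noteq> f b"
    have "f \<in> invariants P'" "f \<in> invariants Q'" using f by (auto simp: invariants_Un)
    then show "top_degree (Bimap (insert_ribbon x y a P') (insert_ribbon x y b Q') E)"
      using top_iff[OF ribbon(1)[OF ab(1)] ribbon(2)[OF ab(2)]]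
        ribbon_ribbon_top_degree_disconnected[OF P' Q' ab top _ _ f(3)] by blast
  next
    fix a b assume ab: "a \<in> X'" "b \<in> X'"
      and conn: "\<And>f. f \<in> invariants (P' \<union> E') \<Longrightarrow> f \<in> invariants (Q' \<union> E') \<Longrightarrow> f a = f b"
    \<comment> \<open>In a top-degree map the corners alone connect each component, so ends in one
      component lie on one face.\<close>
    have "h a = h b" if "h \<in> invariants P'" "h \<in> invariants Q'" for h
      using conn[of h] that top by (auto simp: invariants_Un)
    then show "top_degree (Bimap (insert_ribbon x y a P') (insert_ribbon x y b Q') E) \<longleftrightarrow> (d b = d a) = False"
      unfolding top_iff[OF ribbon(1)[OF ab(1)] ribbon(2)[OF ab(2)]]
      using ribbon_ribbon_top_degree_connected[OF P' Q' ab top d] by simp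
  qed
qed

end

text \<open>Deletion maps these sets to each other because it acts on the labels by
  \<open>forget\<close>; the sets \<open>extensions\<close> are its fibres.\<close>

lemma maps_along_Cons:
  assumes E'_eq: "E' = set es"
  shows "maps_along t ({x, y} # es) I J =
    (\<Union>M'\<in>maps_along t es (forget I) (forget J). extensions t I J M')"
proof -
  have notin: "{x, y} \<notin> E'" using pair_mem[OF E'] new by blast
  have U: "\<Union>(set ({x, y} # es)) = X" "\<Union>(set es) = X'"
    using pairing_Union[OF E'] unfolding E'_eq by auto
  have rem: "remove_edge {x, y} (Bimap P Q E) =
      Bimap (merge_corners {x, y} P) (merge_corners {x, y} Q) E'" for P Q
    unfolding remove_edge_def using notin by simp
  have set: "set ({x, y} # es) = E" "set es = E'" using E'_eq by auto
  show ?thesis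
  proof (intro equalityI subsetI)
    fix p assume "p \<in> maps_along t ({x, y} # es) I J"
    then obtain P Q where p: "p = (P, Q)" and P: "pairing_on X P" and Q: "pairing_on X Q"
      and key: "invariants (P \<union> E) = I" "invariants (Q \<union> E) = J"
      and t: "t (Bimap P Q E)" "along t es (remove_edge {x, y} (Bimap P Q E))"
      unfolding maps_along_def U(1) unfolding set by auto
    have "(merge_corners {x, y} P, merge_corners {x, y} Q) \<in> maps_along t es (forget I) (forget J)"
      unfolding maps_along_def U(2) unfolding set
      using merge_corners_cases(1)[OF new P] merge_corners_cases(1)[OF new Q]
        forget_invariants[OF P] forget_invariants[OF Q] key t(2) rem by simp
    moreover have "p \<in> extensions t I J (merge_corners {x, y} P, merge_corners {x, y} Q)"
      unfolding extensions_def p using P Q key t(1) by simp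
    ultimately show "p \<in> (\<Union>M'\<in>maps_along t es (forget I) (forget J). extensions t I J M')" by blast
  next
    fix p assume "p \<in> (\<Union>M'\<in>maps_along t es (forget I) (forget J). extensions t I J M')"
    then obtain P' Q' where M': "(P', Q') \<in> maps_along t es (forget I) (forget J)"
      and "p \<in> extensions t I J (P', Q')" by auto
    then obtain P Q where "p = (P, Q)" "pairing_on X P" "merge_corners {x, y} P = P'"
      "invariants (P \<union> E) = I" "pairing_on X Q" "merge_corners {x, y} Q = Q'"
      "invariants (Q \<union> E) = J" "t (Bimap P Q E)"
      unfolding extensions_def by auto
    moreover have "along t es (Bimap P' Q' E')" using M' unfolding maps_along_def set by simp
    ultimately show "p \<in> maps_along t ({x, y} # es) I J"
      unfolding maps_along_def U(1) unfolding set by (simp add: rem)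
  qed
qed

lemma card_maps_along_Cons:
  assumes E'_eq: "E' = set es"
    and ext: "\<And>P' Q'. pairing_on X' P' \<Longrightarrow> pairing_on X' Q' \<Longrightarrow> invariants (P' \<union> E') = forget I \<Longrightarrow>
      invariants (Q' \<union> E') = forget J \<Longrightarrow> t (Bimap P' Q' E') \<Longrightarrow> card (extensions t I J (P', Q')) = N"
  shows "card (maps_along t ({x, y} # es) I J) = N * card (maps_along t es (forget I) (forget J))"
proof -
  let ?S = "maps_along t es (forget I) (forget J)"
  have fin: "finite ?S" using finite_maps_along E' unfolding E'_eq by blast
  have "pairing_on X (set ({x, y} # es))"
    using pairing_insert_edge[OF new E'] unfolding E'_eq by simp
  then have finC: "finite (maps_along t ({x, y} # es) I J)" by (rule finite_maps_along)
  have U: "\<Union>(set es) = X'" using pairing_Union[OF E'] unfolding E'_eq .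
  have N: "card (extensions t I J M') = N" if "M' \<in> ?S" for M'
  proof -
    obtain P' Q' where M': "M' = (P', Q')" by (cases M')
    with that have F: "pairing_on X' P'" "pairing_on X' Q'" "invariants (P' \<union> E') = forget I"
      "invariants (Q' \<union> E') = forget J" "along t es (Bimap P' Q' E')"
      using mem_maps_along[OF E'[unfolded E'_eq]] unfolding E'_eq by auto
    show ?thesis unfolding M' by (rule ext[OF F(1-4) along_imp[OF F(5)]])
  qed
  have "card (maps_along t ({x, y} # es) I J) = (\<Sum>M'\<in>?S. card (extensions t I J M'))"
    unfolding maps_along_Cons[OF E'_eq]
  proof (rule card_UN_disjoint[OF fin])
    show "\<forall>M'\<in>?S. finite (extensions t I J M')"
      using finC unfolding maps_along_Cons[OF E'_eq] by (blast intro: finite_subset)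
    show "\<forall>M'\<in>?S. \<forall>M''\<in>?S. M' \<noteq> M'' \<longrightarrow> extensions t I J M' \<inter> extensions t I J M'' = {}"
      unfolding extensions_def by (auto simp: prod_eq_iff)
  qed
  also have "\<dots> = N * card ?S" using N by simp
  finally show ?thesis .
qed

lemma card_maps_along_Cons_eq:
  assumes E'_eq: "E' = set es"
    and IH: "\<And>I J. card (maps_along top_degree es I J) = card (maps_along orientable es I J)"
  shows "card (maps_along top_degree ({x, y} # es) I J) = card (maps_along orientable ({x, y} # es) I J)"
\<comment> \<open>The extension counts presuppose that \<open>I\<close> and \<open>J\<close> are
  realised by pairings; if one is not, both sets are empty.\<close>
proof (cases "\<exists>P0 Q0. pairing_on X P0 \<and> I = invariants (P0 \<union> E) \<and> pairing_on X Q0 \<and> J = invariants (Q0 \<union> E)")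
  case True
  then obtain P0 Q0 where *: "pairing_on X P0" "I = invariants (P0 \<union> E)"
    "pairing_on X Q0" "J = invariants (Q0 \<union> E)" by blast
  have "card (maps_along top_degree ({x, y} # es) I J) =
      extension_count I J * card (maps_along top_degree es (forget I) (forget J))"
    by (rule card_maps_along_Cons[OF E'_eq], rule card_extensions_top_degree[OF *])
  also have "\<dots> = extension_count I J * card (maps_along orientable es (forget I) (forget J))"
    using IH by simp
  also have "\<dots> = card (maps_along orientable ({x, y} # es) I J)"
    by (rule card_maps_along_Cons[OF E'_eq, symmetric], rule card_extensions_orientable[OF *])
  finally show ?thesis .
next
  case False
  have U: "\<Union>(set ({x, y} # es)) = X" "set ({x, y} # es) = E"
    using pairing_Union[OF E'] unfolding E'_eq by auto
  have "maps_along t ({x, y} # es) I J = {}" for t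
    unfolding maps_along_def U(1) unfolding U(2) using False by blast
  then show ?thesis by simp
qed

end

lemma edge_insertionI:
  assumes "pairing_on X (set (e # es))" "e \<notin> set es"
  obtains x y where "e = {x, y}" "edge_insertion x y (\<Union>(set es)) (set es)"
    "X = insert x (insert y (\<Union>(set es)))"
proof -
  have p: "partition_on X (insert e (set es))" and c: "\<And>p. p \<in> insert e (set es) \<Longrightarrow> card p = 2"
    using assms(1) unfolding pairing_on_def by auto
  obtain x y where e: "e = {x, y}" "x \<noteq> y" using c[of e] by (auto simp: card_2_iff)
  have "e \<inter> \<Union>(set es) = {}" using p assms(2) unfolding partition_on_def disjoint_def by fastforce
  moreover have "pairing_on (\<Union>(set es)) (set es)"
    using p c unfolding pairing_on_def partition_on_def disjoint_def by auto
  moreover have "finite p" if "p \<in> set es" for p using c[of p] that by (auto intro: card_ge_0_finite)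
  then have "finite (\<Union>(set es))" by blast
  ultimately have "edge_insertion x y (\<Union>(set es)) (set es)"
    using e by unfold_locales auto
  moreover have "X = insert x (insert y (\<Union>(set es)))"
    using p e(1) unfolding partition_on_def by auto
  ultimately show ?thesis using that e(1) by blast
qed

text \<open>Both cardinalities satisfy the same recursion, with factor
  \<open>extension_count I J\<close> for realised labels. The induction ranges over all
  \<open>I\<close> and \<open>J\<close> because the recursion changes them.\<close>

lemma card_maps_along_eq:
  assumes "pairing_on X (set es)" "distinct es"
  shows "card (maps_along top_degree es I J) = card (maps_along orientable es I J)"
  using assms
proof (induction es arbitrary: X I J)
  case Nil
  have "pairing_on {} P \<Longrightarrow> P = {}" for P :: "'a set set"
    unfolding pairing_on_def partition_on_def by auto
  moreover have "top_degree (Bimap {} {} ({} :: 'a set set))" "orientable (Bimap {} {} ({} :: 'a set set))"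
    unfolding top_degree_def components_def orbits_def orientable_def boundary_orientation_def by auto
  ultimately have "maps_along top_degree [] I J = maps_along orientable [] I J"
    unfolding maps_along_def by auto
  then show ?case by simp
next
  case (Cons e es)
  obtain x y where e: "e = {x, y}" and "edge_insertion x y (\<Union>(set es)) (set es)"
    using edge_insertionI[OF Cons.prems(1)] Cons.prems(2) by (metis distinct.simps(2))
  then interpret edge_insertion x y "\<Union>(set es)" "set es" by simp
  show ?case unfolding e
    by (rule card_maps_along_Cons_eq[OF refl]) (use Cons.IH E' Cons.prems(2) in auto)
qed

lemma along_orientable_iff:
  assumes "nonoriented_map X (Bimap P Q (set es))" "distinct es"
  shows "along orientable es (Bimap P Q (set es)) \<longleftrightarrow> orientable (Bimap P Q (set es))"
  using assms
proof (induction es arbitrary: X P Q)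
  case (Cons e es)
  have PQ: "pairing_on X P" "pairing_on X Q" "pairing_on X (set (e # es))"
    using Cons.prems(1) unfolding nonoriented_map_def by auto
  obtain x y where e: "e = {x, y}" and i: "edge_insertion x y (\<Union>(set es)) (set es)"
    and X: "X = insert x (insert y (\<Union>(set es)))"
    using edge_insertionI[OF PQ(3)] Cons.prems(2) by (metis distinct.simps(2))
  interpret edge_insertion x y "\<Union>(set es)" "set es" by (rule i)
  note PX = PQ(1)[unfolded X] and QX = PQ(2)[unfolded X]
  have rem: "remove_edge e (Bimap P Q (set (e # es))) =
      Bimap (merge_corners e P) (merge_corners e Q) (set es)"
    unfolding remove_edge_def using Cons.prems(2) by simp
  have "nonoriented_map (\<Union>(set es)) (Bimap (merge_corners e P) (merge_corners e Q) (set es))"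
    unfolding nonoriented_map_def e
    using merge_corners_cases(1)[OF new PX] merge_corners_cases(1)[OF new QX] E' by simp
  then have "along orientable es (Bimap (merge_corners e P) (merge_corners e Q) (set es)) \<longleftrightarrow>
      orientable (Bimap (merge_corners e P) (merge_corners e Q) (set es))"
    using Cons.IH Cons.prems(2) by simp
  then show ?case using orientable_remove_edge[OF PX QX] rem e by auto
qed simp

section \<open>Increasing enumerations of the edges\<close>

text \<open>Removes the choice of a list from \<open>top_degree_pair\<close>: a history has only one
  increasing enumeration.\<close>

lemma sorted_wrt_unique:
  assumes "antisym r" "sorted_wrt (\<lambda>e f. (e, f) \<in> r) xs" "sorted_wrt (\<lambda>e f. (e, f) \<in> r) ys"
    "distinct xs" "distinct ys" "set xs = set ys"
  shows "xs = ys"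
  using assms(2-)
proof (induction xs arbitrary: ys)
  case (Cons x xs)
  then obtain y zs where ys: "ys = y # zs" by (cases ys) auto
  have "x = y"
  proof (rule ccontr)
    assume "x \<noteq> y"
    then have "x \<in> set zs" "y \<in> set xs" using Cons.prems(5) unfolding ys by auto
    then have "(x, y) \<in> r" "(y, x) \<in> r" using Cons.prems(1,2) unfolding ys by auto
    then show False using assms(1) \<open>x \<noteq> y\<close> unfolding antisym_def by blast
  qed
  moreover have "xs = zs"
    using Cons.prems \<open>x = y\<close> unfolding ys by (intro Cons.IH) auto
  ultimately show ?case unfolding ys by simp
qed simp

lemma ex_sorted_wrt:
  assumes "finite A" "trans r" "\<And>a b. a \<in> A \<Longrightarrow> b \<in> A \<Longrightarrow> (a, b) \<in> r \<or> (b, a) \<in> r"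
  shows "\<exists>xs. distinct xs \<and> set xs = A \<and> sorted_wrt (\<lambda>a b. (a, b) \<in> r) xs"
  using assms(1,3)
proof (induction "card A" arbitrary: A)
  case (Suc n)
  have "A \<noteq> {}" using Suc.hyps(2) by auto
  with Suc.prems(1) have "\<exists>m\<in>A. \<forall>a\<in>A. (m, a) \<in> r" using Suc.prems(2)
  proof (induction rule: finite_ne_induct)
    case (insert b A)
    then obtain m where m: "m \<in> A" "\<And>a. a \<in> A \<Longrightarrow> (m, a) \<in> r" by blast
    show ?case
    proof (cases "(m, b) \<in> r")
      case True then show ?thesis using m by auto
    next
      case False
      then have "(b, m) \<in> r" using insert.prems m(1) by blast
      moreover have "(b, b) \<in> r" using insert.prems by blast
      ultimately show ?thesis using m transD[OF assms(2)] by blast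
    qed
  qed auto
  then obtain m where m: "m \<in> A" "\<And>a. a \<in> A \<Longrightarrow> (m, a) \<in> r" by blast
  have "n = card (A - {m})" using Suc.hyps(2) m(1) Suc.prems(1) by simp
  then obtain xs where "distinct xs" "set xs = A - {m}" "sorted_wrt (\<lambda>a b. (a, b) \<in> r) xs"
    using Suc.hyps(1)[of "A - {m}"] Suc.prems by auto
  then show ?case using m by (intro exI[of _ "m # xs"]) auto
qed auto

section \<open>From equinumerous fibres to the bijection\<close>

lemma bij_betw_fibrewise:
  assumes fin: "\<And>k. finite {a \<in> A. key a = k}" "\<And>k. finite {b \<in> B. key b = k}"
    and card: "\<And>k. card {a \<in> A. key a = k} = card {b \<in> B. key b = k}"
  shows "\<exists>\<Psi>. bij_betw \<Psi> A B \<and> (\<forall>a\<in>A. key (\<Psi> a) = key a)"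
proof -
  have "\<exists>h. bij_betw h {a \<in> A. key a = k} {b \<in> B. key b = k}" for k
    using fin card finite_same_card_bij by blast
  then obtain h where h: "\<And>k. bij_betw (h k) {a \<in> A. key a = k} {b \<in> B. key b = k}" by metis
  define \<Psi> where "\<Psi> a = h (key a) a" for a
  have mem: "\<Psi> a \<in> B \<and> key (\<Psi> a) = key a" if "a \<in> A" for a
    using bij_betwE[OF h[of "key a"]] that unfolding \<Psi>_def by simp
  have "inj_on \<Psi> A"
  proof (rule inj_onI)
    fix a a' assume aa: "a \<in> A" "a' \<in> A" "\<Psi> a = \<Psi> a'"
    then have "key a = key a'" using mem by metis
    then show "a = a'"
      using aa inj_onD[OF bij_betw_imp_inj_on[OF h[of "key a"]]] unfolding \<Psi>_def by auto
  qed
  moreover have "B \<subseteq> \<Psi> ` A"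
  proof
    fix b assume "b \<in> B"
    then have "b \<in> h (key b) ` {a \<in> A. key a = key b}" using h[of "key b"] unfolding bij_betw_def by blast
    then show "b \<in> \<Psi> ` A" unfolding \<Psi>_def by force
  qed
  ultimately have "bij_betw \<Psi> A B" using mem unfolding bij_betw_def by blast
  then show ?thesis using mem by blast
qed

text \<open>This is what the bijection preserves. For a fixed set of sides the invariants determine
  the orbits, hence the vertices as sets of sides, so equal keys make the identity an isomorphism of
  bicolored graphs.\<close>

definition map_key :: "'a bimap \<times> 'a set rel \<Rightarrow>
    'a set set \<times> 'a set rel \<times> ('a \<Rightarrow> bool) set \<times> ('a \<Rightarrow> bool) set" where
  "map_key = (\<lambda>(M, r). (edges M, r, invariants (black_corners M \<union> edges M),
     invariants (white_corners M \<union> edges M)))"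

lemma bicolored_graph_isomorphicI:
  assumes "nonoriented_map X M" "nonoriented_map X M'" "map_key (M, r) = map_key (M', r')"
  shows "bicolored_graph_isomorphic M M'"
proof -
  have U: "\<Union>(black_corners N) = X" "\<Union>(white_corners N) = X" "\<Union>(edges N) = X"
    if "nonoriented_map X N" for N
    using that pairing_Union unfolding nonoriented_map_def by auto
  have "edges M = edges M'" using assms(3) unfolding map_key_def by simp
  moreover have "black_vertices M = black_vertices M'"
    unfolding black_vertices_def
    by (rule orbits_cong) (use assms(3) U[OF assms(1)] U[OF assms(2)] in \<open>auto simp: map_key_def\<close>)
  moreover have "white_vertices M = white_vertices M'"
    unfolding white_vertices_def
    by (rule orbits_cong) (use assms(3) U[OF assms(1)] U[OF assms(2)] in \<open>auto simp: map_key_def\<close>)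
  ultimately show ?thesis unfolding bicolored_graph_isomorphic_def
    by (intro exI[of _ id]) auto
qed

lemma fibre_eq:
  assumes E: "pairing_on X E" and lin: "linear_order_on E r"
    and es: "distinct es" "set es = E" "sorted_wrt (\<lambda>e f. (e, f) \<in> r) es"
  shows "{p \<in> {(M, r). nonoriented_map X M \<and> card (edges M) = card E \<and> top_degree_pair M r}.
      map_key p = (E, r, I, J)} = (\<lambda>(P, Q). (Bimap P Q E, r)) ` maps_along top_degree es I J"
    and "{p \<in> {(M, r). nonoriented_map X M \<and> card (edges M) = card E \<and> orientable M \<and> history M r}.
      map_key p = (E, r, I, J)} = (\<lambda>(P, Q). (Bimap P Q E, r)) ` maps_along orientable es I J"
proof -
  have mem: "(P, Q) \<in> maps_along t es I J \<longleftrightarrow> pairing_on X P \<and> pairing_on X Q \<and>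
      invariants (P \<union> E) = I \<and> invariants (Q \<union> E) = J \<and> along t es (Bimap P Q E)" for t P Q
    using mem_maps_along[of X es] E es(2) by simp
  have hist: "history (Bimap P Q E) r" for P Q unfolding history_def using lin by simp
  have anti: "antisym r" using lin unfolding linear_order_on_def partial_order_on_def by blast
  have order: "edges_in_order (Bimap P Q E) r es' \<longleftrightarrow> es' = es" for P Q es'
    unfolding edges_in_order_def using es sorted_wrt_unique[OF anti, of es' es] by auto
  have top: "top_degree_pair (Bimap P Q E) r \<longleftrightarrow> along top_degree es (Bimap P Q E)" for P Q
    unfolding top_degree_pair_def order along_iff using hist by auto
  have ori: "along orientable es (Bimap P Q E) \<longleftrightarrow> orientable (Bimap P Q E)"
    if "nonoriented_map X (Bimap P Q E)" for P Q
    using along_orientable_iff that es(1,2) by metis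
  have nm: "nonoriented_map X (Bimap P Q E) \<longleftrightarrow> pairing_on X P \<and> pairing_on X Q" for P Q
    unfolding nonoriented_map_def using E by simp
  show "{p \<in> {(M, r). nonoriented_map X M \<and> card (edges M) = card E \<and> top_degree_pair M r}.
      map_key p = (E, r, I, J)} = (\<lambda>(P, Q). (Bimap P Q E, r)) ` maps_along top_degree es I J"
    (is "?L = ?R")
  proof (intro equalityI subsetI)
    fix p assume p: "p \<in> ?L"
    obtain P Q E0 r0 where p_eq: "p = (Bimap P Q E0, r0)" by (metis bimap.exhaust surj_pair)
    with p have "E0 = E" "r0 = r" unfolding map_key_def by auto
    then have "(P, Q) \<in> maps_along top_degree es I J" "p = (Bimap P Q E, r)"
      using p unfolding p_eq mem by (auto simp: top nm map_key_def)
    then show "p \<in> ?R" by (auto intro: image_eqI)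
  next
    fix p assume "p \<in> ?R"
    then show "p \<in> ?L" by (auto simp: mem top nm map_key_def)
  qed
  show "{p \<in> {(M, r). nonoriented_map X M \<and> card (edges M) = card E \<and> orientable M \<and> history M r}.
      map_key p = (E, r, I, J)} = (\<lambda>(P, Q). (Bimap P Q E, r)) ` maps_along orientable es I J"
    (is "?L = ?R")
  proof (intro equalityI subsetI)
    fix p assume p: "p \<in> ?L"
    obtain P Q E0 r0 where p_eq: "p = (Bimap P Q E0, r0)" by (metis bimap.exhaust surj_pair)
    with p have "E0 = E" "r0 = r" unfolding map_key_def by auto
    then have "(P, Q) \<in> maps_along orientable es I J" "p = (Bimap P Q E, r)"
      using p unfolding p_eq mem by (auto simp: ori nm map_key_def)
    then show "p \<in> ?R" by (auto intro: image_eqI)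
  next
    fix p assume "p \<in> ?R"
    then show "p \<in> ?L" by (auto simp: mem ori hist nm map_key_def)
  qed
qed

theorem theorem1p8:
  fixes X :: "'a set" and n :: nat
  assumes "n \<ge> 1" and "card X = 2 * n"
  shows "\<exists>\<Psi>.
    bij_betw \<Psi>
      {(M, r). nonoriented_map X M \<and> card (edges M) = n \<and> top_degree_pair M r}
      {(M, r). nonoriented_map X M \<and> card (edges M) = n \<and> orientable M \<and> history M r} \<and>
    (\<forall>M r M' r'. nonoriented_map X M \<and> card (edges M) = n \<and> top_degree_pair M r \<and>
       \<Psi> (M, r) = (M', r') \<longrightarrow> bicolored_graph_isomorphic M M')"
proof -
  let ?A = "{(M, r). nonoriented_map X M \<and> card (edges M) = n \<and> top_degree_pair M r}"
  let ?B = "{(M, r). nonoriented_map X M \<and> card (edges M) = n \<and> orientable M \<and> history M r}"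
  \<comment> \<open>\<open>n \<ge> 1\<close> makes \<open>card X\<close> positive, which excludes an
    infinite \<open>X\<close>.\<close>
  have finX: "finite X" using assms by (intro card_ge_0_finite) simp
  have fibres: "finite {p \<in> ?A. map_key p = k} \<and> finite {p \<in> ?B. map_key p = k} \<and>
      card {p \<in> ?A. map_key p = k} = card {p \<in> ?B. map_key p = k}" for k
  proof -
    obtain E r I J where k: "k = (E, r, I, J)" by (metis surj_pair)
    show ?thesis
    proof (cases "pairing_on X E \<and> n = card E \<and> linear_order_on E r")
      case True
      then have "E \<subseteq> Pow X" using pairing_Union by blast
      then have "finite E" using finX finite_subset by blast
      moreover have "trans r" "(a, b) \<in> r \<or> (b, a) \<in> r" if "a \<in> E" "b \<in> E" for a b
        using True that unfolding linear_order_on_def partial_order_on_def preorder_on_def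
          refl_on_def total_on_def by metis+
      ultimately obtain es where es: "distinct es" "set es = E" "sorted_wrt (\<lambda>e f. (e, f) \<in> r) es"
        using ex_sorted_wrt[of E r] True
        unfolding linear_order_on_def partial_order_on_def preorder_on_def by blast
      have inj: "inj_on (\<lambda>(P, Q). (Bimap P Q E, r)) S" for S by (auto simp: inj_on_def)
      have X: "pairing_on X (set es)" using True es(2) by simp
      have A: "{p \<in> ?A. map_key p = k} = (\<lambda>(P, Q). (Bimap P Q E, r)) ` maps_along top_degree es I J"
        and B: "{p \<in> ?B. map_key p = k} = (\<lambda>(P, Q). (Bimap P Q E, r)) ` maps_along orientable es I J"
        unfolding k using fibre_eq[OF _ _ es, of X I J] True by simp_all
      show ?thesis unfolding A B card_image[OF inj]
        using finite_maps_along[OF X] card_maps_along_eq[OF X es(1)] by simp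
    next
      \<comment> \<open>A key that is not a linear order on a pairing of \<open>X\<close> with
        \<open>n\<close> pairs occurs for neither kind.\<close>
      case False
      then have "{p \<in> ?A. map_key p = k} = {}" "{p \<in> ?B. map_key p = k} = {}"
        unfolding k map_key_def nonoriented_map_def top_degree_pair_def history_def by auto
      then show ?thesis by (simp only: card.empty finite.emptyI simp_thms)
    qed
  qed
  have "\<exists>\<Psi>. bij_betw \<Psi> ?A ?B \<and> (\<forall>p\<in>?A. map_key (\<Psi> p) = map_key p)"
    by (rule bij_betw_fibrewise) (use fibres in \<open>simp_all only:\<close>)
  then obtain \<Psi> where \<Psi>: "bij_betw \<Psi> ?A ?B" "\<forall>p\<in>?A. map_key (\<Psi> p) = map_key p"
    by (elim exE conjE)
  have "bicolored_graph_isomorphic M M'"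
    if "nonoriented_map X M" "card (edges M) = n" "top_degree_pair M r" "\<Psi> (M, r) = (M', r')" for M r M' r'
  proof -
    have "(M, r) \<in> ?A" using that by simp
    from bspec[OF \<Psi>(2) this] bspec[OF bij_betwE[OF \<Psi>(1)] this]
    have "map_key (M', r') = map_key (M, r)" "(M', r') \<in> ?B" unfolding that(4) .
    then show ?thesis using bicolored_graph_isomorphicI[OF that(1) _ sym] by blast
  qed
  then show ?thesis using \<Psi>(1) by blast
qed

end
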